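(* Let $\mathbb{C}$ be endowed with the trivial filtration ($\mathbb{C}_\mu=\mathbb{C}$ for every $\mu\in\mathbb{N}$). Then: (i) $K_0^{loc}(\mathbb{C}) = \mathbb{Z}$ (up to isomorphism of abelian groups). (ii) $$K_1^{loc}(\mathbb{C}) = \bigoplus_{n\ge 1} \mathbb{Z}_2\,[J_{n,-1}]\ \oplus\ \bigoplus_{n\ge 2}\mathbb{Z}_2\,[J_{n,1}]\ \oplus\ \bigoplus_{n\ge 1,\ \hat\lambda\in\hat{\mathbb{C}}}\mathbb{Z}\,[J_{n,\hat\lambda}],$$ that is, $K_1^{loc}(\mathbb{C})$ is the internal direct sum of cyclic subgroups of order $2$ generated by the classes $[J_{n,-1}]$ ($n\ge 1$), cyclic subgroups of order $2$ generated by the classes $[J_{n,1}]$ ($n\ge 2$), and infinite cyclic subgroups generated by the classes $[J_{n,\hat\lambda}]$ ($n\ge1$, $\hat\lambda\in\hat{\mathbb{C}}$). The group structure in $K_1^{loc}(\mathbb{C})$ is provided by the relations $$m_1[J_{n,\lambda}]+m_2[J_{n,\lambda^{-1}}]=(m_1-m_2)[J_{n,\lambda}]\quad\text{for any } m_1,m_2\in\mathbb{N},$$ $$-m[J_{n,\lambda}]=m[J_{n,\lambda^{-1}}]\quad\text{for any } m\in\mathbb{Z},$$ for every $n\ge 1$ and every $\lambda\in\mathbb{C}\setminus\{0\}$.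
   Context: Jordan cells: for $n\ge 1$ and $\lambda\in\mathbb{C}\setminus\{0\}$, $J_{n,\lambda}\in GL_n(\mathbb{C})$ is the $n\times n$ Jordan cell with $\lambda$ on the diagonal, $1$ on the first superdiagonal and $0$ elsewhere; $J_{1,\lambda}=\lambda\cdot 1_1$, where $1_1$ is the $1\times1$ identity matrix. Let $\bar{\mathbb{C}}=\mathbb{C}\setminus\{-1,0,1\}$, with the equivalence relation $\lambda\sim_r\lambda'$ iff $\lambda=\lambda'$ or $\lambda^{-1}=\lambda'$, and let $\hat{\mathbb{C}}=\bar{\mathbb{C}}/\sim_r$. For $\hat\lambda\in\hat{\mathbb{C}}$, $[J_{n,\hat\lambda}]$ denotes the class $[J_{n,\lambda}]$ for a chosen representative $\lambda$ of $\hat\lambda$ (choosing the other representative $\lambda^{-1}$ changes the class by a sign). $K_0^{loc}(\mathbb{C})$: the Grothendieck completion (with respect to direct sum) of the idempotent complex square matrices of all sizes, modulo stabilisation ($p\sim_s p\oplus 0$) and conjugation by invertible matrices; in general one then takes the projective limit over the filtration index $\mu$, which for the trivial filtration is constant. $K_1^{loc}(\mathbb{C})$: in general it is the projective limit over $\mu$ of groups $K_1(\mathbb{C}_\mu)$; for the trivial filtration all these groups coincide and $K_1^{loc}(\mathbb{C})$ is the quotient of the set of invertible complex square matrices of all sizes $n\ge1$ by the equivalence relation generated by: (1) stabilisation: $u\sim_s u\oplus 1_1$; (2) conjugation $\sim_l$: $u\sim_l gug^{-1}$ for $u,g\in GL_n(\mathbb{C})$ (since the filtration is trivial, all conjugations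 are allowed); (3) $\sim_{\mathbb{O}}$: $u\sim u\oplus\xi$ for $\xi\in\mathbb{O}(\mathbb{C})$, where $\mathbb{O}(\mathbb{C})$ consists of the finite direct sums of matrices of the form $v\oplus v^{-1}$ with $v$ an invertible complex matrix. The class of $u$ is denoted $[u]$, and addition is induced by direct sum: $[u]+[v]=[u\oplus v]$. With this operation $K_1^{loc}(\mathbb{C})$ is an abelian group in which $[1_1]=0$ and $[v\oplus v^{-1}]=0$. *)

theory Defs
  imports
    "HOL-Algebra.Free_Abelian_Groups"
    "HOL-Algebra.Generated_Groups"
    "Jordan_Normal_Form.Jordan_Normal_Form"
begin

section \<open>General constructions on groups and monoids\<close>

definition grothendieck_rel :: "('a, 'm) monoid_scheme \<Rightarrow> (('a \<times> 'a) \<times> ('a \<times> 'a)) set" where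
  "grothendieck_rel M = {((a, b), (c, d)). a \<in> carrier M \<and> b \<in> carrier M \<and>
     c \<in> carrier M \<and> d \<in> carrier M \<and>
     (\<exists>e \<in> carrier M. (a \<otimes>\<^bsub>M\<^esub> d) \<otimes>\<^bsub>M\<^esub> e = (c \<otimes>\<^bsub>M\<^esub> b) \<otimes>\<^bsub>M\<^esub> e)}"

text \<open>The class of \<open>(a, b)\<close> stands for the formal difference \<open>a - b\<close>.\<close>

definition grothendieck_group :: "('a, 'm) monoid_scheme \<Rightarrow> ('a \<times> 'a) set monoid" where
  "grothendieck_group M =
     \<lparr>carrier = (carrier M \<times> carrier M) // grothendieck_rel M,
      monoid.mult = (\<lambda>X Y. \<Union>(a, b) \<in> X. \<Union>(c, d) \<in> Y.
                grothendieck_rel M `` {(a \<otimes>\<^bsub>M\<^esub> c, b \<otimes>\<^bsub>M\<^esub> d)}),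
      monoid.one = grothendieck_rel M `` {(\<one>\<^bsub>M\<^esub>, \<one>\<^bsub>M\<^esub>)}\<rparr>"

text \<open>Projective limit of a tower \<open>G 0 \<longleftarrow> G 1 \<longleftarrow> G 2 \<longleftarrow> \<dots>\<close> with transition maps
  \<open>\<phi> \<mu> : G (\<mu> + 1) \<longrightarrow> G \<mu>\<close>.\<close>

definition projective_limit ::
    "(nat \<Rightarrow> ('a, 'm) monoid_scheme) \<Rightarrow> (nat \<Rightarrow> 'a \<Rightarrow> 'a) \<Rightarrow> (nat \<Rightarrow> 'a) monoid" where
  "projective_limit G \<phi> = (product_group UNIV G)
     \<lparr>carrier := {x \<in> carrier (product_group UNIV G). \<forall>\<mu>. \<phi> \<mu> (x (Suc \<mu>)) = x \<mu>}\<rparr>"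

definition internal_direct_sum ::
    "('a, 'm) monoid_scheme \<Rightarrow> 'i set \<Rightarrow> ('i \<Rightarrow> 'a set) \<Rightarrow> bool" where
  "internal_direct_sum G I H \<longleftrightarrow>
     (\<forall>i \<in> I. subgroup (H i) G) \<and>
     (\<lambda>x. gfinprod G x I) \<in> iso (sum_group I (\<lambda>i. G\<lparr>carrier := H i\<rparr>)) G"

section \<open>The group \<open>K\<^sub>0\<close>\<close>

definition idempotent_mats :: "complex mat set" where
  "idempotent_mats = {p. \<exists>n \<ge> 1. p \<in> carrier_mat n n \<and> p * p = p}"

definition K0_step :: "complex mat \<Rightarrow> complex mat \<Rightarrow> bool" where
  "K0_step p q \<longleftrightarrow> p \<in> idempotent_mats \<and>
     ((\<exists>k \<ge> 1. q = diag_block_mat [p, 0\<^sub>m k k]) \<or> similar_mat q p)"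

definition K0_rel :: "(complex mat \<times> complex mat) set" where
  "K0_rel = {(p, q). equivclp K0_step p q}"

definition idempotent_monoid :: "complex mat set monoid" where
  "idempotent_monoid =
     \<lparr>carrier = idempotent_mats // K0_rel,
      monoid.mult = (\<lambda>X Y. \<Union>p \<in> X. \<Union>q \<in> Y. K0_rel `` {diag_block_mat [p, q]}),
      monoid.one = K0_rel `` {0\<^sub>m 1 1}\<rparr>"

definition K0 :: "(complex mat set \<times> complex mat set) set monoid" where
  "K0 = grothendieck_group idempotent_monoid"

text \<open>For the trivial filtration, \<open>\<complex>\<^sub>\<mu> = \<complex>\<close> for every \<open>\<mu>\<close>, the tower is constant: every level
  is the same group and every transition map is the identity.\<close>

definition K0_loc :: "(nat \<Rightarrow> (complex mat set \<times> complex mat set) set) monoid" where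
  "K0_loc = projective_limit (\<lambda>\<mu>. K0) (\<lambda>\<mu> x. x)"

section \<open>The group \<open>K\<^sub>1\<close>\<close>

definition GL_mats :: "complex mat set" where
  "GL_mats = {u. \<exists>n \<ge> 1. u \<in> carrier_mat n n \<and> invertible_mat u}"

text \<open>Finite direct sums of matrices \<open>v \<oplus> v\<^sup>-\<^sup>1\<close>; the list entries are the pairs \<open>(v, v\<^sup>-\<^sup>1)\<close>.\<close>

definition O_mats :: "complex mat set" where
  "O_mats = {diag_block_mat (map (\<lambda>(v, w). diag_block_mat [v, w]) vs) | vs.
     vs \<noteq> [] \<and>
     (\<forall>(v, w) \<in> set vs. v \<in> GL_mats \<and> w \<in> GL_mats \<and> inverts_mat v w \<and> inverts_mat w v)}"

definition K1_step :: "complex mat \<Rightarrow> complex mat \<Rightarrow> bool" where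
  "K1_step u v \<longleftrightarrow> u \<in> GL_mats \<and>
     (v = diag_block_mat [u, 1\<^sub>m 1] \<or> similar_mat v u \<or>
      (\<exists>\<xi> \<in> O_mats. v = diag_block_mat [u, \<xi>]))"

definition K1_rel :: "(complex mat \<times> complex mat) set" where
  "K1_rel = {(u, v). equivclp K1_step u v}"

definition K1 :: "complex mat set monoid" where
  "K1 =
     \<lparr>carrier = GL_mats // K1_rel,
      monoid.mult = (\<lambda>X Y. \<Union>u \<in> X. \<Union>v \<in> Y. K1_rel `` {diag_block_mat [u, v]}),
      monoid.one = K1_rel `` {1\<^sub>m 1}\<rparr>"

definition K1_loc :: "(nat \<Rightarrow> complex mat set) monoid" where
  "K1_loc = projective_limit (\<lambda>\<mu>. K1) (\<lambda>\<mu> x. x)"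

text \<open>The class \<open>[u]\<close>, as a compatible family of classes.\<close>

definition K1_class :: "complex mat \<Rightarrow> (nat \<Rightarrow> complex mat set)" where
  "K1_class u = (\<lambda>\<mu>. K1_rel `` {u})"

section \<open>Jordan classes\<close>

definition C_bar :: "complex set" where
  "C_bar = UNIV - {-1, 0, 1}"

definition inv_rel :: "(complex \<times> complex) set" where
  "inv_rel = {(a, b). a \<in> C_bar \<and> b \<in> C_bar \<and> (a = b \<or> inverse a = b)}"

definition C_hat :: "complex set set" where
  "C_hat = C_bar // inv_rel"

datatype jordan_index = Minus nat | Plus nat | Hat nat "complex set"

definition jordan_indices :: "jordan_index set" where
  "jordan_indices =
     {Minus n | n. n \<ge> 1} \<union> {Plus n | n. n \<ge> 2} \<union> {Hat n c | n c. n \<ge> 1 \<and> c \<in> C_hat}"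

text \<open>\<open>rep\<close> chooses a representative of each class in \<open>C_hat\<close>.\<close>

fun jordan_gen :: "(complex set \<Rightarrow> complex) \<Rightarrow> jordan_index \<Rightarrow> (nat \<Rightarrow> complex mat set)" where
  "jordan_gen rep (Minus n) = K1_class (jordan_block n (-1))"
| "jordan_gen rep (Plus n) = K1_class (jordan_block n 1)"
| "jordan_gen rep (Hat n c) = K1_class (jordan_block n (rep c))"

end

theory Submission
  imports Defs
    "Jordan_Normal_Form.Jordan_Normal_Form_Existence"
    "Jordan_Normal_Form.Jordan_Normal_Form_Uniqueness"
begin

text \<open>Up to conjugation a complex square matrix is the multiset of its Jordan blocks, and direct sum
  is addition of multisets. An idempotent has only the blocks \<open>1\<close> and \<open>0\<close>; stabilisation forgets the
  latter, so the isomorphism classes form the monoid of natural numbers (the rank), whose Grothendieck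
  group is that of the integers.

  Inverting a matrix replaces each block \<open>(n, a)\<close> by \<open>(n, a\<^sup>-\<^sup>1)\<close>. Hence the number of blocks
  \<open>(n, a)\<close> minus the number of blocks \<open>(n, a\<^sup>-\<^sup>1)\<close> is unchanged by adding \<open>v \<oplus> v\<^sup>-\<^sup>1\<close>, and for
  \<open>a = \<plusminus>1\<close> the number of blocks \<open>(n, a)\<close> is unchanged modulo \<open>2\<close>; only the block \<open>(1, 1)\<close> is affected
  by stabilisation. These counts are homomorphisms dual to the proposed generators, and the generators
  do generate because every invertible matrix is conjugate to a sum of Jordan blocks.\<close>

section \<open>Jordan blocks of complex matrices\<close>

text \<open>Both relations are equivalence closures of single moves, and no normal form for their
  classes is available. Two classes are shown equal by exhibiting moves, and different by a function
  of the Jordan blocks that every single move preserves. The relation behind \<open>K1\<close> is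
  never described exactly: each count is 1 on its own generator and 0 on every other one, and this
  duality, the orders of the generators and generation already force the direct sum. Nor is the
  Jordan form of an inverse computed explicitly. Block counts are read off from dimensions of
  generalised kernels, and these coincide for a matrix at \<open>a\<close> and its inverse matrix at
  \<open>inverse a\<close>. The same fact identifies the inverse of a single Jordan block up to
  conjugation, which yields the relations between \<open>a\<close> and \<open>inverse a\<close> and
  the generators of order 2. All matrices have positive size, so rank 0 and empty block lists need
  separate care.\<close>

abbreviation block_sum :: "'a :: zero mat \<Rightarrow> 'a mat \<Rightarrow> 'a mat" (infixr "\<boxplus>" 65) where
  "A \<boxplus> B \<equiv> diag_block_mat [A, B]"

lemma block_sum_four_block:
  "A \<boxplus> B = four_block_mat A (0\<^sub>m (dim_row A) (dim_col B)) (0\<^sub>m (dim_row B) (dim_col A)) B"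
  unfolding diag_block_mat.simps(2)[of A "[B]"] Let_def diag_block_mat_singleton ..

lemma block_sum_carrier [simp]:
  "A \<in> carrier_mat n n \<Longrightarrow> B \<in> carrier_mat m m \<Longrightarrow> A \<boxplus> B \<in> carrier_mat (n + m) (n + m)"
  unfolding block_sum_four_block by (rule four_block_carrier_mat)

lemma block_sum_eq:
  assumes "A \<in> carrier_mat n n" "B \<in> carrier_mat m m"
  shows "A \<boxplus> B = four_block_mat A (0\<^sub>m n m) (0\<^sub>m m n) B"
  unfolding block_sum_four_block using assms by auto

lemma block_sum_append: "diag_block_mat As \<boxplus> diag_block_mat Bs = diag_block_mat (As @ Bs)"
  unfolding diag_block_mat_append block_sum_four_block Let_def ..

lemma block_sum_Cons: "diag_block_mat (A # As) = A \<boxplus> diag_block_mat As"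
  using block_sum_append[of "[A]" As] unfolding diag_block_mat_singleton by (simp only: append.simps)

text \<open>Both sides flatten to the block list \<open>[A, B, C]\<close>, so this is an equality
  rather than a similarity, for matrices of any size.\<close>

lemma block_sum_assoc: "(A \<boxplus> B) \<boxplus> C = A \<boxplus> (B \<boxplus> C)"
  using block_sum_append[of "[A, B]" "[C]"] block_sum_append[of "[A]" "[B, C]"]
  unfolding diag_block_mat_singleton by (simp only: append.simps)

lemma similar_block_sum:
  assumes "similar_mat A A'" "similar_mat B B'"
  shows "similar_mat (A \<boxplus> B) (A' \<boxplus> B')"
  using similar_diag_mat_block_mat[of "[(A, A'), (B, B')]"] assms by auto

lemma similar_block_sum_swap:
  fixes A B :: "'a :: comm_ring_1 mat"
  assumes A: "A \<in> carrier_mat n n" and B: "B \<in> carrier_mat m m"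
  shows "similar_mat (A \<boxplus> B) (B \<boxplus> A)"
proof -
  \<comment> \<open>\<open>?P\<close> is the permutation matrix that exchanges the two groups of
    coordinates; \<open>?Q\<close> is its transpose and inverse.\<close>
  let ?P = "four_block_mat (0\<^sub>m n m) (1\<^sub>m n) (1\<^sub>m m) (0\<^sub>m m n) :: 'a mat"
  let ?Q = "four_block_mat (0\<^sub>m m n) (1\<^sub>m m) (1\<^sub>m n) (0\<^sub>m n m) :: 'a mat"
  have P: "?P \<in> carrier_mat (n + m) (n + m)"
    using four_block_carrier_mat[of "0\<^sub>m n m" n m "0\<^sub>m m n" m n] by (simp add: add.commute)
  have Q: "?Q \<in> carrier_mat (n + m) (n + m)"
    using four_block_carrier_mat[of "0\<^sub>m m n" m n "0\<^sub>m n m" n m] by (simp add: add.commute)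
  have PQ: "?P * ?Q = 1\<^sub>m (n + m)"
    by (subst mult_four_block_mat[of _ n m _ n _ m _ _ n _ m]) auto
  have QP: "?Q * ?P = 1\<^sub>m (n + m)"
    by (subst mult_four_block_mat[of _ m n _ m _ n _ _ m _ n]) (auto simp: add.commute)
  have BA: "?P * (B \<boxplus> A) = four_block_mat (0\<^sub>m n m) A B (0\<^sub>m m n)"
    unfolding block_sum_eq[OF B A]
    by (subst mult_four_block_mat[of _ n m _ n _ m _ _ m _ n]) (use A B in auto)
  have "?P * (B \<boxplus> A) * ?Q = A \<boxplus> B"
    unfolding BA block_sum_eq[OF A B]
    by (subst mult_four_block_mat[of _ n m _ n _ m _ _ n _ m]) (use A B in auto)
  moreover have "B \<boxplus> A \<in> carrier_mat (n + m) (n + m)"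
    using block_sum_carrier[OF B A] by (simp only: add.commute)
  ultimately show ?thesis
    by (intro similar_matI[of _ _ ?P ?Q "n + m"]) (use P Q PQ QP A B in auto)
qed

lemma det_block_sum:
  fixes A B :: "'a :: idom mat"
  assumes "A \<in> carrier_mat n n" "B \<in> carrier_mat m m"
  shows "det (A \<boxplus> B) = det A * det B"
  unfolding block_sum_eq[OF assms] using assms
  by (intro det_four_block_mat_lower_left_zero[where n = n and m = m]) auto

lemma jordan_matrix_append: "jordan_matrix (xs @ ys) = jordan_matrix xs \<boxplus> jordan_matrix ys"
  unfolding jordan_matrix_def by (simp only: map_append block_sum_append)

lemma jordan_matrix_singleton: "jordan_matrix [(n, a)] = jordan_block n a"
  unfolding jordan_matrix_def list.map prod.case diag_block_mat_singleton ..

lemma jordan_nf_block: "n \<ge> 1 \<Longrightarrow> jordan_nf (jordan_block n a) [(n, a)]"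
  unfolding jordan_nf_def jordan_matrix_singleton
  by (auto intro: similar_mat_refl[OF jordan_block_carrier])

lemma jordan_nf_matrix: "0 \<notin> fst ` set xs \<Longrightarrow> jordan_nf (jordan_matrix xs) xs"
  unfolding jordan_nf_def by (auto intro: similar_mat_refl[OF jordan_matrix_carrier])

lemma jordan_nf_block_sum:
  "jordan_nf A xs \<Longrightarrow> jordan_nf B ys \<Longrightarrow> jordan_nf (A \<boxplus> B) (xs @ ys)"
  using jordan_nf_diag_block_mat[of "[(A, xs), (B, ys)]"] by auto

lemma jordan_nf_similar: "similar_mat A B \<Longrightarrow> jordan_nf B xs \<Longrightarrow> jordan_nf A xs"
  unfolding jordan_nf_def using similar_mat_trans by blast

lemma jordan_matrix_perm:
  fixes xs ys :: "(nat \<times> 'a :: comm_ring_1) list"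
  shows "mset xs = mset ys \<Longrightarrow> similar_mat (jordan_matrix xs) (jordan_matrix ys)"
proof (induction xs arbitrary: ys)
  case Nil
  then show ?case by (auto intro: similar_mat_refl[OF jordan_matrix_carrier])
next
  case (Cons x xs)
  then have "x \<in> set ys" by (metis list.set_intros(1) mset_eq_setD)
  \<comment> \<open>The lists \<open>as @ [x] @ bs\<close> and \<open>[x] @ bs @ as\<close> differ
    by one exchange of two direct summands, which brings \<open>x\<close> to the front.\<close>
  then obtain as bs where ys: "ys = as @ x # bs" by (meson split_list)
  have "mset xs = mset (bs @ as)" using Cons.prems ys by simp
  then have 1: "similar_mat (jordan_matrix xs) (jordan_matrix (bs @ as))" by (rule Cons.IH)
  have "similar_mat (jordan_matrix ([x] @ xs)) (jordan_matrix ([x] @ bs @ as))"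
    unfolding jordan_matrix_append[of "[x]"]
    by (intro similar_block_sum 1 similar_mat_refl[OF jordan_matrix_carrier])
  moreover have "similar_mat (jordan_matrix (([x] @ bs) @ as)) (jordan_matrix (as @ [x] @ bs))"
    unfolding jordan_matrix_append[of as] jordan_matrix_append[of _ as]
    by (intro similar_block_sum_swap[OF jordan_matrix_carrier jordan_matrix_carrier])
  ultimately show ?case unfolding ys using similar_mat_trans by auto
qed

text \<open>The number of blocks of given size and eigenvalue is computed from dimensions of
  generalised eigenspaces of \<open>A\<close> alone, hence is the same for any two Jordan
  forms.\<close>

lemma jordan_nf_mset_unique:
  fixes A :: "'a :: field mat"
  assumes "jordan_nf A xs" "jordan_nf A ys"
  shows "mset xs = mset ys"
proof (rule multiset_eqI)
  fix x :: "nat \<times> 'a"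
  obtain k a where x: "x = (k, a)" by force
  have count: "count (mset zs) x = (if k = 0 then 0 else compute_nr_of_jordan_blocks A a k)"
    if "jordan_nf A zs" for zs
  proof (cases "k = 0")
    case True
    then show ?thesis using that x by (force simp: jordan_nf_def count_eq_zero_iff)
  next
    case False
    then show ?thesis using compute_nr_of_jordan_blocks[OF that, of k a]
      by (simp add: count_mset count_list_eq_length_filter x)
  qed
  show "count (mset xs) x = count (mset ys) x" using count assms by simp
qed

text \<open>A list of blocks is unique only up to order, so \<open>THE\<close> ranges over
  multisets.\<close>

definition jblocks :: "complex mat \<Rightarrow> (nat \<times> complex) multiset" where
  "jblocks A = (THE M. \<exists>xs. jordan_nf A xs \<and> M = mset xs)"

lemma jblocks_eq: "jordan_nf A xs \<Longrightarrow> jblocks A = mset xs"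
  unfolding jblocks_def by (rule the_equality) (auto dest: jordan_nf_mset_unique)

lemma jordan_nf_ex:
  fixes A :: "complex mat"
  assumes "A \<in> carrier_mat n n"
  obtains xs where "jordan_nf A xs"
  using char_poly_factorized[OF assms] jordan_nf_exists[OF assms] by metis

text \<open>Matrices with equal blocks are similar to Jordan matrices that differ by a permutation
  of the blocks. Similarities of direct sums thereby become identities between sums of
  multisets.\<close>

lemma similar_iff_jblocks:
  assumes "A \<in> carrier_mat n n" "B \<in> carrier_mat m m"
  shows "similar_mat A B \<longleftrightarrow> jblocks A = jblocks B"
proof -
  obtain xs ys where nf: "jordan_nf A xs" "jordan_nf B ys"
    using jordan_nf_ex assms by metis
  show ?thesis
  proof
    assume "similar_mat A B"
    then show "jblocks A = jblocks B"
      using nf(2) jordan_nf_similar jblocks_eq by metis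
  next
    assume "jblocks A = jblocks B"
    then have "similar_mat (jordan_matrix xs) (jordan_matrix ys)"
      using nf jblocks_eq by (intro jordan_matrix_perm) auto
    then show "similar_mat A B"
      using nf unfolding jordan_nf_def by (meson similar_mat_trans similar_mat_sym)
  qed
qed

lemma jblocks_block_sum:
  assumes "A \<in> carrier_mat n n" "B \<in> carrier_mat m m"
  shows "jblocks (A \<boxplus> B) = jblocks A + jblocks B"
proof -
  obtain xs ys where nf: "jordan_nf A xs" "jordan_nf B ys"
    using jordan_nf_ex assms by metis
  show ?thesis
    using jblocks_eq[OF jordan_nf_block_sum[OF nf]] nf[THEN jblocks_eq] by simp
qed

lemma jblocks_jordan_block: "n \<ge> 1 \<Longrightarrow> jblocks (jordan_block n a) = {#(n, a)#}"
  using jblocks_eq[OF jordan_nf_block] by simp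

text \<open>Used with \<open>a = 1\<close> for identity matrices and with \<open>a = 0\<close> for
  zero matrices.\<close>

lemma jordan_matrix_scalar:
  fixes a :: "'a :: semiring_1"
  shows "jordan_matrix (replicate k (1, a)) = a \<cdot>\<^sub>m 1\<^sub>m k"
proof (induction k)
  case 0
  show ?case by (intro eq_matI) auto
next
  case (Suc k)
  have 1: "jordan_block 1 a = a \<cdot>\<^sub>m 1\<^sub>m 1"
    by (intro eq_matI) (auto simp: jordan_block_def)
  have "jordan_matrix ([(1, a)] @ replicate k (1, a)) = a \<cdot>\<^sub>m 1\<^sub>m (Suc k)"
    unfolding jordan_matrix_append Suc jordan_matrix_singleton 1
    by (subst block_sum_eq[of _ 1 _ k]) (auto intro!: eq_matI)
  then show ?case by simp
qed

lemma jblocks_scalar: "jblocks (a \<cdot>\<^sub>m 1\<^sub>m k) = replicate_mset k (1, a)"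
  using jblocks_eq[OF jordan_nf_matrix, of "replicate k (1, a)"]
  unfolding jordan_matrix_scalar by auto

lemma jblocks_one: "jblocks (1\<^sub>m k) = replicate_mset k (1, 1)"
proof -
  have "(1 :: complex) \<cdot>\<^sub>m 1\<^sub>m k = 1\<^sub>m k" by (intro eq_matI) auto
  then show ?thesis using jblocks_scalar[of 1 k] by simp
qed

lemma jblocks_zero: "jblocks (0\<^sub>m k k) = replicate_mset k (1, 0)"
proof -
  have "(0 :: complex) \<cdot>\<^sub>m 1\<^sub>m k = 0\<^sub>m k k" by (intro eq_matI) auto
  then show ?thesis using jblocks_scalar[of 0 k] by simp
qed

lemma similar_mat_square:
  "similar_mat A B \<Longrightarrow> A \<in> carrier_mat n n \<Longrightarrow> B \<in> carrier_mat n n"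
  by (metis similar_matD carrier_matD(1) insert_subset)

section \<open>Generalised kernels of an inverse matrix\<close>

lemma mult_mat_exchange:
  fixes X Y U V :: "'a :: semiring_1 mat"
  assumes "X \<in> carrier_mat n n" "Y \<in> carrier_mat n n" "U \<in> carrier_mat n n" "V \<in> carrier_mat n n"
    and "Y * U = U * Y"
  shows "(X * Y) * (U * V) = (X * U) * (Y * V)"
proof -
  have "(X * Y) * (U * V) = X * ((Y * U) * V)"
    using assms(1-4) by (simp add: assoc_mult_mat[of _ n n _ n _ n])
  also have "\<dots> = (X * U) * (Y * V)"
    unfolding assms(5) using assms(1-4) by (simp add: assoc_mult_mat[of _ n n _ n _ n])
  finally show ?thesis .
qed

text \<open>The second conjunct is what the induction step of the first one needs: it moves the new
  factor \<open>X\<close> past \<open>Y ^\<^sub>m k\<close>.\<close>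

lemma pow_mat_mult_commute:
  fixes X Y :: "'a :: semiring_1 mat"
  assumes X: "X \<in> carrier_mat n n" and Y: "Y \<in> carrier_mat n n" and XY: "X * Y = Y * X"
  shows "(X * Y) ^\<^sub>m k = X ^\<^sub>m k * Y ^\<^sub>m k \<and> Y ^\<^sub>m k * X = X * Y ^\<^sub>m k"
proof (induction k)
  case 0
  then show ?case using X Y by auto
next
  case (Suc k)
  have C: "X ^\<^sub>m k \<in> carrier_mat n n" "Y ^\<^sub>m k \<in> carrier_mat n n" using X Y by auto
  have "(X * Y) ^\<^sub>m Suc k = (X ^\<^sub>m k * Y ^\<^sub>m k) * (X * Y)" using Suc by simp
  also have "\<dots> = X ^\<^sub>m Suc k * Y ^\<^sub>m Suc k"
    using mult_mat_exchange[OF C X Y] Suc by simp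
  finally have 1: "(X * Y) ^\<^sub>m Suc k = X ^\<^sub>m Suc k * Y ^\<^sub>m Suc k" .
  have "Y ^\<^sub>m Suc k * X = Y ^\<^sub>m k * (X * Y)"
    using X Y C XY by (simp add: assoc_mult_mat[of _ n n _ n _ n])
  also have "\<dots> = (Y ^\<^sub>m k * X) * Y" using X Y C by (simp add: assoc_mult_mat[of _ n n _ n _ n])
  also have "\<dots> = X * Y ^\<^sub>m Suc k"
    using X Y C Suc by (simp add: assoc_mult_mat[of _ n n _ n _ n])
  finally show ?case using 1 by blast
qed

text \<open>Since \<open>V\<^sup>-\<^sup>1 - a\<^sup>-\<^sup>1 = - a\<^sup>-\<^sup>1 V\<^sup>-\<^sup>1 (V - a)\<close> with commuting factors, both sides have the same
  generalised kernels.\<close>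

lemma dim_gen_eigenspace_inverse:
  fixes V W :: "complex mat"
  assumes V: "V \<in> carrier_mat n n" and W: "W \<in> carrier_mat n n"
    and VW: "V * W = 1\<^sub>m n" and WV: "W * V = 1\<^sub>m n" and a: "a \<noteq> 0"
  shows "dim_gen_eigenspace W (inverse a) k = dim_gen_eigenspace V a k"
proof -
  \<comment> \<open>\<open>?X\<close> has the inverse \<open>?Z\<close> and commutes with
    \<open>?Y\<close>, and \<open>?X * ?Y\<close> is \<open>W\<close> minus \<open>inverse a\<close>
    on the diagonal. The powers of the two characteristic matrices thus differ by the invertible
    factor \<open>?X ^\<^sub>m k\<close>, which does not change the kernel.\<close>
  let ?X = "(- inverse a) \<cdot>\<^sub>m W" and ?Y = "char_matrix V a" and ?Z = "(- a) \<cdot>\<^sub>m V"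
  have C: "?X \<in> carrier_mat n n" "?Y \<in> carrier_mat n n" "?Z \<in> carrier_mat n n"
    using V W by auto
  have WY: "W * ?Y = 1\<^sub>m n + (- a) \<cdot>\<^sub>m W"
    unfolding char_matrix_def using V W WV
    by (subst mult_add_distrib_mat[of _ n n]) (auto simp: mult_smult_distrib[of _ n n _ n])
  have YW: "?Y * W = 1\<^sub>m n + (- a) \<cdot>\<^sub>m W"
    unfolding char_matrix_def using V W VW
    by (subst add_mult_distrib_mat[of _ n n]) (auto simp: mult_smult_assoc_mat[of _ n n _ n])
  have comm: "?X * ?Y = ?Y * ?X"
    using WY YW C V W
    by (simp add: mult_smult_assoc_mat[of _ n n _ n] mult_smult_distrib[of _ n n _ n])
  have "?X * ?Y = (- inverse a) \<cdot>\<^sub>m (1\<^sub>m n + (- a) \<cdot>\<^sub>m W)"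
    using WY C V W by (simp add: mult_smult_assoc_mat[of _ n n _ n])
  also have "\<dots> = char_matrix W (inverse a)"
    unfolding char_matrix_def using W a by (intro eq_matI) (auto simp: field_simps)
  finally have eq: "char_matrix W (inverse a) = ?X * ?Y" ..
  have ZX: "?Z * ?X = 1\<^sub>m n" and XZ: "?X * ?Z = 1\<^sub>m n"
    using V W VW WV a
    by (auto simp: mult_smult_assoc_mat[of _ n n _ n] mult_smult_distrib[of _ n n _ n] intro!: eq_matI)
  have pow_one: "1\<^sub>m n ^\<^sub>m k = (1\<^sub>m n :: complex mat)" for k by (induction k) auto
  have inv: "?Z ^\<^sub>m k * ?X ^\<^sub>m k = 1\<^sub>m n"
    using pow_mat_mult_commute[OF C(3,1), of k] ZX XZ pow_one[of k] by simp
  have "mat_kernel (char_matrix W (inverse a) ^\<^sub>m k) = mat_kernel (?Y ^\<^sub>m k)"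
    unfolding eq using pow_mat_mult_commute[OF C(1,2) comm, of k]
      mat_kernel_mult_eq[of "?Y ^\<^sub>m k" n n "?X ^\<^sub>m k" "?Z ^\<^sub>m k"] inv C by simp
  moreover have "dim_col (char_matrix W (inverse a) ^\<^sub>m k) = n" "dim_col (?Y ^\<^sub>m k) = n"
    using V W by (intro pow_mat_dim_square(2); simp)+
  ultimately show ?thesis
    unfolding dim_gen_eigenspace_def kernel_dim_def by simp
qed


section \<open>Determinants, and block counts of an inverse matrix\<close>

lemma det_jordan_matrix:
  fixes xs :: "(nat \<times> 'a :: idom) list"
  shows "det (jordan_matrix xs) = (\<Prod>(n, a)\<leftarrow>xs. a ^ n)"
proof (induction xs)
  case Nil
  have "jordan_matrix [] \<in> carrier_mat 0 0" using jordan_matrix_carrier[of "[]"] by simp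
  then have "det (jordan_matrix [] :: 'a mat) = 1" by (rule det_dim_zero)
  then show ?case by simp
next
  case (Cons x xs)
  obtain n a where x: "x = (n, a)" by force
  have "det (jordan_block n a) = prod_list (diag_mat (jordan_block n a))"
    by (rule det_upper_triangular[of _ n]) auto
  also have "diag_mat (jordan_block n a) = replicate n a"
    unfolding diag_mat_def by (intro nth_equalityI) auto
  finally have "det (jordan_block n a) = a ^ n" by simp
  moreover have "jordan_matrix (x # xs) = jordan_block n a \<boxplus> jordan_matrix xs"
    using jordan_matrix_append[of "[x]" xs] by (simp add: jordan_matrix_singleton x del: diag_block_mat.simps)
  ultimately show ?case
    using Cons det_block_sum[OF jordan_block_carrier jordan_matrix_carrier, of n a xs]
    by (simp add: x del: diag_block_mat.simps)
qed

lemma jblocks_size_pos: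
  assumes "A \<in> carrier_mat n n" "(k, a) \<in># jblocks A"
  shows "k \<ge> 1"
proof -
  obtain xs where "jordan_nf A xs" using jordan_nf_ex[OF assms(1)] .
  moreover from this have "(k, a) \<in> set xs" using assms(2) jblocks_eq by fastforce
  ultimately show ?thesis unfolding jordan_nf_def by force
qed

text \<open>Blocks have positive size, so a factor \<open>a ^ n\<close> of the determinant vanishes
  only for \<open>a = 0\<close>.\<close>

lemma det_eq_0_iff_jblocks:
  assumes A: "A \<in> carrier_mat n n"
  shows "det A = 0 \<longleftrightarrow> 0 \<in> snd ` set_mset (jblocks A)"
proof -
  obtain xs where xs: "jordan_nf A xs" using jordan_nf_ex[OF A] .
  have "det A = (\<Prod>(n, a)\<leftarrow>xs. a ^ n)"
    using xs det_similar det_jordan_matrix unfolding jordan_nf_def by metis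
  also have "\<dots> = 0 \<longleftrightarrow> 0 \<in> snd ` set xs"
    using xs unfolding jordan_nf_def by (force simp: prod_list_zero_iff)
  finally show ?thesis using jblocks_eq[OF xs] by simp
qed

lemma count_jblocks:
  assumes "A \<in> carrier_mat n n"
  shows "count (jblocks A) (k, a) = (if k = 0 then 0 else compute_nr_of_jordan_blocks A a k)"
proof (cases "k = 0")
  case True
  then show ?thesis using jblocks_size_pos[OF assms, of k a] by (auto simp: count_eq_zero_iff)
next
  case False
  obtain xs where xs: "jordan_nf A xs" using jordan_nf_ex[OF assms] .
  show ?thesis using compute_nr_of_jordan_blocks[OF xs False, of a] False
    by (simp add: jblocks_eq[OF xs] count_mset count_list_eq_length_filter)
qed

text \<open>Block counts are combinations of dimensions of generalised eigenspaces, and those of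
  \<open>W\<close> at \<open>inverse a\<close> are those of \<open>V\<close> at
  \<open>a\<close>.\<close>

lemma count_jblocks_inverse:
  assumes V: "V \<in> carrier_mat n n" and W: "W \<in> carrier_mat n n"
    and "V * W = 1\<^sub>m n" "W * V = 1\<^sub>m n" "a \<noteq> 0"
  shows "count (jblocks W) (k, inverse a) = count (jblocks V) (k, a)"
  unfolding count_jblocks[OF V] count_jblocks[OF W] compute_nr_of_jordan_blocks_def
  using dim_gen_eigenspace_inverse[OF assms] by simp

lemma jblocks_jordan_block_inverse:
  assumes W: "W \<in> carrier_mat n n" and "n \<ge> 1" "a \<noteq> 0"
    and VW: "jordan_block n a * W = 1\<^sub>m n" "W * jordan_block n a = 1\<^sub>m n"
  shows "jblocks W = {#(n, inverse a)#}"
proof (rule multiset_eqI)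
  fix x :: "nat \<times> complex"
  obtain k b where x: "x = (k, b)" by force
  show "count (jblocks W) x = count {#(n, inverse a)#} x"
  proof (cases "b = 0")
    \<comment> \<open>The comparison of counts covers nonzero eigenvalues only; the eigenvalue 0 is
      ruled out because \<open>W\<close> is invertible.\<close>
    case True
    have "det W * det (jordan_block n a) = 1"
      using det_mult[OF W, of "jordan_block n a"] VW by simp
    then have "(k, 0) \<notin># jblocks W" using det_eq_0_iff_jblocks[OF W] by force
    then show ?thesis using assms(3) True x by (simp add: count_eq_zero_iff)
  next
    case False
    then have "count (jblocks W) (k, inverse (inverse b)) = count (jblocks (jordan_block n a)) (k, inverse b)"
      using VW W by (intro count_jblocks_inverse) auto
    then show ?thesis using jblocks_jordan_block[OF \<open>n \<ge> 1\<close>] False x by auto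
  qed
qed

lemma jblocks_similar: "similar_mat A B \<Longrightarrow> jblocks A = jblocks B"
  by (metis similar_matD insert_subset similar_iff_jblocks)

section \<open>Jordan blocks of idempotents\<close>

lemma jordan_matrix_idempotent:
  assumes "jordan_matrix xs * jordan_matrix xs = (jordan_matrix xs :: complex mat)" "0 \<notin> fst ` set xs"
  shows "set xs \<subseteq> {(1, 0), (1, 1)}"
  using assms
proof (induction xs)
  case (Cons x xs)
  obtain n a where x: "x = (n, a)" by force
  let ?J = "jordan_block n a" and ?m = "sum_list (map fst xs)"
  have J: "jordan_matrix (x # xs) = four_block_mat ?J (0\<^sub>m n ?m) (0\<^sub>m ?m n) (jordan_matrix xs)"
    using jordan_matrix_append[of "[x]" xs] block_sum_eq[of ?J n "jordan_matrix xs" ?m]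
    by (simp add: jordan_matrix_singleton x del: diag_block_mat.simps)
  have JJ: "jordan_matrix (x # xs) * jordan_matrix (x # xs)
      = four_block_mat (?J * ?J) (0\<^sub>m n ?m) (0\<^sub>m ?m n) (jordan_matrix xs * jordan_matrix xs)"
    unfolding J by (subst mult_four_block_mat[of _ n n _ ?m _ ?m _ _ n _ ?m]) auto
  have eq: "four_block_mat (?J * ?J) (0\<^sub>m n ?m) (0\<^sub>m ?m n) (jordan_matrix xs * jordan_matrix xs)
      = four_block_mat ?J (0\<^sub>m n ?m) (0\<^sub>m ?m n) (jordan_matrix xs)"
    using Cons.prems(1) unfolding J JJ[unfolded J] .
  have 1: "(?J * ?J) $$ (i, j) = ?J $$ (i, j)" if "i < n" "j < n" for i j
    using arg_cong[OF eq, of "\<lambda>M. M $$ (i, j)"] that by simp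
  have "(jordan_matrix xs * jordan_matrix xs) $$ (i, j) = jordan_matrix xs $$ (i, j)"
    if "i < ?m" "j < ?m" for i j
    using arg_cong[OF eq, of "\<lambda>M. M $$ (i + n, j + n)"] that by simp
  then have "jordan_matrix xs * jordan_matrix xs = jordan_matrix xs"
    by (intro eq_matI) auto
  with Cons have IH: "set xs \<subseteq> {(1, 0), (1, 1)}" by auto
  have JJ2: "?J * ?J = mat n n (\<lambda>(i, j). if i \<le> j then of_nat (2 choose (j - i)) * a ^ (2 + i - j) else 0)"
    using jordan_block_pow[of n a 2] by (simp add: numeral_2_eq_2)
  have n: "n \<ge> 1" using Cons.prems(2) x by auto
  then have a: "a * a = a" using 1[of 0 0] JJ2 by (simp add: power2_eq_square)
  have "n < 2"
  proof (rule ccontr)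
    assume "\<not> n < 2"
    \<comment> \<open>The entry at (0, 1) is \<open>2 * a\<close> in the square and \<open>1\<close>
      in the block. Multiplying \<open>a * a = a\<close> by 4 then turns \<open>2 * a = 1\<close>
      into \<open>1 = 2\<close>.\<close>
    then have "2 * a = 1" using 1[of 0 1] JJ2 by simp
    moreover from a have "(2 * a) * (2 * a) = 2 * (2 * a)" by simp
    ultimately show False by simp
  qed
  with n have "n = 1" by simp
  moreover from a have "a = 0 \<or> a = 1" by auto
  ultimately show ?case using IH x by auto
qed simp

lemma similar_mat_idempotent:
  assumes "similar_mat A B" "B * B = B"
  shows "A * A = A"
proof -
  obtain n P Q where C: "A \<in> carrier_mat n n" "B \<in> carrier_mat n n" "P \<in> carrier_mat n n" "Q \<in> carrier_mat n n"
    and PQ: "P * Q = 1\<^sub>m n" "Q * P = 1\<^sub>m n" and A: "A = P * B * Q"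
    using similar_matD[OF assms(1)] by auto
  have "A * A = P * (B * (Q * P) * B) * Q"
    unfolding A using C(2-) by (simp add: assoc_mult_mat[of _ n n _ n _ n])
  then show ?thesis using PQ C A assms(2) by simp
qed

lemma jblocks_idempotent:
  assumes A: "A \<in> carrier_mat n n" and "A * A = A"
  shows "set_mset (jblocks A) \<subseteq> {(1, 0), (1, 1)}"
proof -
  obtain xs where xs: "jordan_nf A xs" using jordan_nf_ex[OF A] .
  then have "jordan_matrix xs * jordan_matrix xs = jordan_matrix xs" "0 \<notin> fst ` set xs"
    using similar_mat_idempotent[OF similar_mat_sym assms(2)] unfolding jordan_nf_def by auto
  then show ?thesis using jordan_matrix_idempotent jblocks_eq[OF xs] by simp
qed

section \<open>Abelian groups\<close>

lemma card_generate_2: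
  assumes "group G" "a \<in> carrier G" "a \<noteq> \<one>\<^bsub>G\<^esub>" "a \<otimes>\<^bsub>G\<^esub> a = \<one>\<^bsub>G\<^esub>"
  shows "card (generate G {a}) = 2"
proof -
  interpret group G by fact
  have a2: "a [^]\<^bsub>G\<^esub> (2 :: int) = \<one>\<^bsub>G\<^esub>"
    using assms int_pow_mult[of a 1 1] by simp
  have pow: "a [^]\<^bsub>G\<^esub> k = a [^]\<^bsub>G\<^esub> (k mod 2)" for k :: int
  proof -
    have "a [^]\<^bsub>G\<^esub> k = a [^]\<^bsub>G\<^esub> (2 * (k div 2) + k mod 2)" by simp
    also have "\<dots> = a [^]\<^bsub>G\<^esub> (k mod 2)"
      using assms(2) a2 by (simp only: int_pow_mult flip: int_pow_pow) simp
    finally show ?thesis .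
  qed
  have "generate G {a} = {\<one>\<^bsub>G\<^esub>, a}"
  proof
    show "generate G {a} \<subseteq> {\<one>\<^bsub>G\<^esub>, a}"
    proof
      fix x assume "x \<in> generate G {a}"
      then obtain k :: int where "x = a [^]\<^bsub>G\<^esub> (k mod 2)"
        using generate_pow[OF assms(2)] pow by auto
      moreover have "k mod 2 = 0 \<or> k mod 2 = 1" by presburger
      ultimately show "x \<in> {\<one>\<^bsub>G\<^esub>, a}" using assms(2) by auto
    qed
  qed (auto intro: generate.intros)
  then show ?thesis using assms(3) by simp
qed

text \<open>The character sends the k-th power of \<open>a\<close> to \<open>k * \<chi> a\<close>,
  so distinct exponents give distinct powers.\<close>

lemma infinite_generate:
  assumes "group G" "a \<in> carrier G" "\<chi> \<in> hom G integer_group" "\<chi> a \<noteq> 0"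
  shows "infinite (generate G {a})"
proof
  interpret group G by fact
  interpret X: group_hom G integer_group \<chi>
    using assms(1,3) by (simp add: group_hom_def group_hom_axioms_def)
  assume "finite (generate G {a})"
  moreover have "range (\<lambda>k :: int. a [^]\<^bsub>G\<^esub> k) \<subseteq> generate G {a}"
    using generate_pow[OF assms(2)] by auto
  ultimately have "finite (range (\<lambda>k :: int. a [^]\<^bsub>G\<^esub> k))" by (rule rev_finite_subset)
  then have "\<not> inj (\<lambda>k :: int. a [^]\<^bsub>G\<^esub> k)"
    using finite_imageD infinite_UNIV_int by blast
  then obtain k l :: int where kl: "k \<noteq> l" "a [^]\<^bsub>G\<^esub> k = a [^]\<^bsub>G\<^esub> l"
    unfolding inj_def by blast
  have "\<chi> (a [^]\<^bsub>G\<^esub> k) = k * \<chi> a" for k :: int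
    using X.hom_int_pow[OF assms(2), of k] int_pow_integer_mod_group[of 0 "\<chi> a" k]
    by (simp add: integer_mod_group_def)
  with kl have "k * \<chi> a = l * \<chi> a" by metis
  with kl(1) assms(4) show False by simp
qed

lemma (in comm_group) finprod_hom_zero:
  assumes "\<chi> \<in> hom G (integer_mod_group m)" "finite A" "f \<in> A \<rightarrow> carrier G"
    "\<And>i. i \<in> A \<Longrightarrow> \<chi> (f i) = 0"
  shows "\<chi> (finprod G f A) = 0"
  using assms(2-)
proof (induction A)
  case empty
  then show ?case using hom_one[OF assms(1)] by (simp add: group_axioms)
next
  case (insert i A)
  then show ?case using hom_mult[OF assms(1)] by (simp add: Pi_iff)
qed

text \<open>If a product of elements of the cyclic subgroups is trivial, \<open>\<chi> i\<close>
  sees only the factor at \<open>i\<close> and forces its exponent to vanish modulo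
  \<open>m i\<close>; by \<open>ord\<close> that factor is then trivial. Surjectivity comes from
  \<open>gen\<close>. The case \<open>m i = 0\<close> covers infinite cyclic factors, since
  \<open>k mod 0 = k\<close> and \<open>ord\<close> then speaks of the zeroth power.\<close>

lemma (in comm_group) internal_direct_sumI:
  assumes g: "g \<in> I \<rightarrow> carrier G"
    and \<chi>: "\<And>i. i \<in> I \<Longrightarrow> \<chi> i \<in> hom G (integer_mod_group (m i))"
    and dual: "\<And>i j. i \<in> I \<Longrightarrow> j \<in> I \<Longrightarrow> \<chi> i (g j) = (if i = j then 1 mod int (m i) else 0)"
    and ord: "\<And>i. i \<in> I \<Longrightarrow> g i [^] m i = \<one>"
    and gen: "carrier G \<subseteq> generate G (g ` I)"
  shows "internal_direct_sum G I (\<lambda>i. generate G {g i})"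
proof -
  let ?H = "\<lambda>i. generate G {g i}"
  let ?S = "sum_group I (\<lambda>i. G\<lparr>carrier := ?H i\<rparr>)"
  let ?f = "\<lambda>x. gfinprod G x I"
  have gi: "g i \<in> carrier G" if "i \<in> I" for i using g that by auto
  have sub: "subgroup (?H i) G" if "i \<in> I" for i
    using gi[OF that] by (intro generate_is_subgroup) auto
  have grp: "group (G\<lparr>carrier := ?H i\<rparr>)" if "i \<in> I" for i
    using sub[OF that] by (rule subgroup_imp_group)
  have S: "group ?S" using grp by (rule sum_group)
  have carrS: "x \<in> carrier ?S \<longleftrightarrow> x \<in> (\<Pi>\<^sub>E i\<in>I. ?H i) \<and> finite {i \<in> I. x i \<noteq> \<one>}" for x
    using carrier_sum_group[of I "\<lambda>i. G\<lparr>carrier := ?H i\<rparr>"] grp by auto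
  have H: "?H i \<subseteq> carrier G" if "i \<in> I" for i using sub[OF that] by (rule subgroup.subset)
  \<comment> \<open>This is the homomorphism out of the direct sum induced by the inclusions of the
    subgroups.\<close>
  have "(\<lambda>x. gfinprod G (\<lambda>i. (\<lambda>y. y) (x i)) I) \<in> hom ?S G"
    using grp H by (intro hom_group_sum) (auto simp: hom_def)
  then have hom: "?f \<in> hom ?S G" by simp
  interpret F: group_hom ?S G ?f
    using S hom by (simp add: group_hom_def group_hom_axioms_def)
  have pow: "\<exists>k :: int. y = g i [^] k" if "i \<in> I" "y \<in> ?H i" for i y
    using generate_pow[OF gi[OF that(1)]] that(2) by auto
  have \<chi>pow: "\<chi> i (g j [^] k) = (if i = j then k mod int (m i) else 0)"
    if "i \<in> I" "j \<in> I" for i j and k :: int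
  proof -
    interpret C: group_hom G "integer_mod_group (m i)" "\<chi> i"
      using \<chi>[OF that(1)] by (simp add: group_hom_def group_hom_axioms_def)
    have "\<chi> i (g j [^] k) = (k * \<chi> i (g j)) mod int (m i)"
      unfolding C.hom_int_pow[OF gi[OF that(2)]] by (rule int_pow_integer_mod_group)
    then show ?thesis
      unfolding dual[OF that] using mod_mult_right_eq[of k 1 "int (m j)"] by simp
  qed
  have inj: "x i = \<one>" if x: "x \<in> carrier ?S" and fx: "?f x = \<one>" and i: "i \<in> I" for x i
  proof (rule ccontr)
    assume "x i \<noteq> \<one>"
    let ?A = "{i \<in> I. x i \<noteq> \<one>}"
    have xH: "x j \<in> ?H j" if "j \<in> I" for j using x that carrS by auto
    have fin: "finite ?A" using x carrS by auto
    have xc: "x \<in> I \<rightarrow> carrier G" using xH H by blast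
    \<comment> \<open>\<open>gfinprod\<close> is the product over the finite support
      \<open>?A\<close>. The factor at \<open>i\<close> is split off because \<open>\<chi> i\<close>
      kills all the others.\<close>
    have "\<one> = finprod G x (insert i (?A - {i}))"
      using fx fin i \<open>x i \<noteq> \<one>\<close> by (simp add: gfinprod_def insert_absorb)
    also have "\<dots> = x i \<otimes> finprod G x (?A - {i})"
      using fin xc i by (intro finprod_insert) auto
    finally have eq: "\<one> = x i \<otimes> finprod G x (?A - {i})" .
    have "\<chi> i (x j) = 0" if "j \<in> ?A - {i}" for j
    proof -
      have j: "j \<in> I" "i \<noteq> j" using that by auto
      obtain k :: int where "x j = g j [^] k" using pow[OF j(1) xH[OF j(1)]] by blast
      then show ?thesis using \<chi>pow[OF i j(1), of k] j(2) by simp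
    qed
    note \<chi>0 = this
    have "\<chi> i (finprod G x (?A - {i})) = 0"
      by (rule finprod_hom_zero[OF \<chi>[OF i]])
        (use fin xc in \<open>simp_all add: Pi_iff \<chi>0 del: mem_Collect_eq Diff_iff\<close>, simp add: Pi_iff)
    moreover have "\<chi> i \<one> = 0" using hom_one[OF \<chi>[OF i]] by (simp add: group_axioms)
    moreover have "finprod G x (?A - {i}) \<in> carrier G" using xc by (intro finprod_closed) auto
    moreover obtain k :: int where k: "x i = g i [^] k" using pow[OF i xH[OF i]] by auto
    moreover have "x i \<in> carrier G" using xc i by auto
    ultimately have "0 = (\<chi> i (x i) + 0) mod int (m i)"
      using hom_mult[OF \<chi>[OF i], of "x i" "finprod G x (?A - {i})"] eq by simp
    then have "k mod int (m i) = 0" unfolding k \<chi>pow[OF i i] by simp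
    then obtain l where "k = int (m i) * l" by auto
    then have "x i = (g i [^] int (m i)) [^] l" using k gi[OF i] by (simp add: int_pow_pow)
    then show False using \<open>x i \<noteq> \<one>\<close> ord[OF i] by (simp add: int_pow_int)
  qed
  have "inj_on ?f (carrier ?S)"
    unfolding F.inj_on_one_iff
  proof (intro allI impI)
    fix x assume x: "x \<in> carrier ?S" and fx: "?f x = \<one>"
    \<comment> \<open>Elements of the direct sum are extensional; equality of functions also
      concerns the values outside \<open>I\<close>.\<close>
    have "x i = undefined" if "i \<notin> I" for i
      using x that unfolding carrS by (auto dest: PiE_arb)
    then show "x = \<one>\<^bsub>?S\<^esub>"
      using inj[OF x fx] by (intro ext) (simp add: one_sum_group restrict_def)
  qed
  moreover have "?f ` carrier ?S = carrier G"
  proof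
    show "?f ` carrier ?S \<subseteq> carrier G" using F.hom_closed by auto
    have img: "subgroup (?f ` carrier ?S) G" by (rule F.img_is_subgroup)
    have "g i \<in> ?f ` carrier ?S" if i: "i \<in> I" for i
    proof
      let ?x = "\<lambda>j\<in>I. if j = i then g i else \<one>"
      have "?x j \<in> ?H j" if "j \<in> I" for j
        using that by (auto intro: generate.intros)
      moreover have "finite {j \<in> I. ?x j \<noteq> \<one>}"
        by (rule finite_subset[of _ "{i}"]) auto
      ultimately show "?x \<in> carrier ?S" unfolding carrS by auto
      have "?f ?x = gfinprod G ?x {i}"
        using i gi by (intro gfinprod_mono_neutral_cong_right) auto
      also have "\<dots> = g i" using i gi by simp
      finally show "g i = ?f ?x" ..
    qed
    then have "generate G (g ` I) \<subseteq> ?f ` carrier ?S"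
      by (intro generate_subgroup_incl img) auto
    with gen show "carrier G \<subseteq> ?f ` carrier ?S" by auto
  qed
  ultimately have "?f \<in> iso ?S G" using hom by (simp add: iso_def bij_betw_def)
  then show ?thesis unfolding internal_direct_sum_def using sub by blast
qed

section \<open>Constant projective limits\<close>

lemma carrier_projective_limit_const:
  "carrier (projective_limit (\<lambda>\<mu>. G) (\<lambda>\<mu> x. x)) = (\<lambda>x \<mu>. x) ` carrier G"
proof -
  \<comment> \<open>With identity transition maps, a compatible family does not change from one
    level to the next.\<close>
  have "x = (\<lambda>\<mu>. x 0)" if "\<forall>\<mu>. x (Suc \<mu>) = x \<mu>" for x :: "nat \<Rightarrow> 'a"
  proof
    show "x n = x 0" for n using that by (induction n) auto
  qed
  note const = this
  have carr: "carrier (projective_limit (\<lambda>\<mu>. G) (\<lambda>\<mu> x. x)) =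
      {x. (\<forall>\<mu>. x \<mu> \<in> carrier G) \<and> (\<forall>\<mu>. x (Suc \<mu>) = x \<mu>)}"
    unfolding projective_limit_def by (simp add: PiE_UNIV_domain Pi_iff)
  show ?thesis
    unfolding carr
  proof (intro equalityI subsetI)
    fix x assume x: "x \<in> {x. (\<forall>\<mu>. x \<mu> \<in> carrier G) \<and> (\<forall>\<mu>. x (Suc \<mu>) = x \<mu>)}"
    show "x \<in> (\<lambda>x \<mu>. x) ` carrier G"
      by (rule image_eqI[of _ _ "x 0"]) (use x const in blast)+
  qed auto
qed

lemma mult_projective_limit:
  "x \<otimes>\<^bsub>projective_limit (\<lambda>\<mu>. G) \<phi>\<^esub> y = (\<lambda>\<mu>. x \<mu> \<otimes>\<^bsub>G\<^esub> y \<mu>)"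
  by (auto simp: projective_limit_def)

lemma one_projective_limit: "\<one>\<^bsub>projective_limit (\<lambda>\<mu>. G) \<phi>\<^esub> = (\<lambda>\<mu>. \<one>\<^bsub>G\<^esub>)"
  by (auto simp: projective_limit_def)

lemma projective_limit_const_iso:
  "(\<lambda>x \<mu>. x) \<in> iso G (projective_limit (\<lambda>\<mu>. G) (\<lambda>\<mu> x. x))"
  unfolding iso_def hom_def bij_betw_def
  by (auto simp: carrier_projective_limit_const mult_projective_limit inj_on_def fun_eq_iff)

lemma comm_group_projective_limit_const:
  assumes "comm_group G"
  shows "comm_group (projective_limit (\<lambda>\<mu>. G) (\<lambda>\<mu> x. x))"
proof -
  let ?L = "projective_limit (\<lambda>\<mu>. G) (\<lambda>\<mu> x. x)"
  \<comment> \<open>Transport along the isomorphism gives a group whose unit is overwritten by the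
    image of the unit of \<open>G\<close>. That image is the unit of the limit already, so the
    record is unchanged.\<close>
  have "comm_group (?L\<lparr>one := (\<lambda>\<mu>. \<one>\<^bsub>G\<^esub>)\<rparr>)"
    using comm_group.iso_imp_img_comm_group[OF assms projective_limit_const_iso] .
  moreover have "L\<lparr>one := \<one>\<^bsub>L\<^esub>\<rparr> = L" for L :: "(nat \<Rightarrow> 'a) monoid" by simp
  from this[of ?L] have "?L\<lparr>one := (\<lambda>\<mu>. \<one>\<^bsub>G\<^esub>)\<rparr> = ?L"
    by (simp only: one_projective_limit)
  ultimately show ?thesis by simp
qed

text \<open>The product of two classes is a union over representatives; it collapses once the summed
  class does not depend on them.\<close>

lemma UN2_const:
  assumes "\<And>a b. a \<in> X \<Longrightarrow> b \<in> Y \<Longrightarrow> F a b = C" "X \<noteq> {}" "Y \<noteq> {}"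
  shows "(\<Union>a\<in>X. \<Union>b\<in>Y. F a b) = C"
  using assms by fastforce

section \<open>Grothendieck group of a monoid isomorphic to the natural numbers\<close>

lemma grothendieck_group_nat:
  fixes M :: "('a, 'm) monoid_scheme" and f :: "'a \<Rightarrow> nat"
  assumes bij: "bij_betw f (carrier M) UNIV"
    and closed: "\<And>x y. x \<in> carrier M \<Longrightarrow> y \<in> carrier M \<Longrightarrow> x \<otimes>\<^bsub>M\<^esub> y \<in> carrier M"
    and add: "\<And>x y. x \<in> carrier M \<Longrightarrow> y \<in> carrier M \<Longrightarrow> f (x \<otimes>\<^bsub>M\<^esub> y) = f x + f y"
    and one: "\<one>\<^bsub>M\<^esub> \<in> carrier M" "f \<one>\<^bsub>M\<^esub> = 0"
  shows "comm_group (grothendieck_group M)" "grothendieck_group M \<cong> integer_group"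
proof -
  let ?R = "grothendieck_rel M" and ?G = "grothendieck_group M"
  \<comment> \<open>The integer \<open>d\<close> classifies pairs: additivity of \<open>f\<close>
    cancels the extra summand in \<open>grothendieck_rel\<close>, and injectivity of
    \<open>f\<close> turns equal values into equality in \<open>M\<close>.\<close>
  define d where "d = (\<lambda>(a, b). int (f a) - int (f b))"
  have inj: "x = y" if "x \<in> carrier M" "y \<in> carrier M" "f x = f y" for x y
    using that bij by (auto simp: bij_betw_def inj_on_def)
  have R: "(p, q) \<in> ?R \<longleftrightarrow>
      p \<in> carrier M \<times> carrier M \<and> q \<in> carrier M \<times> carrier M \<and> d p = d q" for p q
  proof -
    obtain a b c e where pq: "p = (a, b)" "q = (c, e)" by force
    have "(\<exists>k\<in>carrier M. (a \<otimes>\<^bsub>M\<^esub> e) \<otimes>\<^bsub>M\<^esub> k = (c \<otimes>\<^bsub>M\<^esub> b) \<otimes>\<^bsub>M\<^esub> k) \<longleftrightarrow> f a + f e = f c + f b"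
      if "a \<in> carrier M" "b \<in> carrier M" "c \<in> carrier M" "e \<in> carrier M"
    proof
      assume "\<exists>k\<in>carrier M. (a \<otimes>\<^bsub>M\<^esub> e) \<otimes>\<^bsub>M\<^esub> k = (c \<otimes>\<^bsub>M\<^esub> b) \<otimes>\<^bsub>M\<^esub> k"
      then obtain k where "k \<in> carrier M"
        "f ((a \<otimes>\<^bsub>M\<^esub> e) \<otimes>\<^bsub>M\<^esub> k) = f ((c \<otimes>\<^bsub>M\<^esub> b) \<otimes>\<^bsub>M\<^esub> k)" by auto
      with that show "f a + f e = f c + f b" by (simp add: add closed)
    next
      assume "f a + f e = f c + f b"
      with that have "a \<otimes>\<^bsub>M\<^esub> e = c \<otimes>\<^bsub>M\<^esub> b" by (intro inj) (auto simp: add closed)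
      then show "\<exists>k\<in>carrier M. (a \<otimes>\<^bsub>M\<^esub> e) \<otimes>\<^bsub>M\<^esub> k = (c \<otimes>\<^bsub>M\<^esub> b) \<otimes>\<^bsub>M\<^esub> k"
        using one(1) by auto
    qed
    then show ?thesis unfolding pq grothendieck_rel_def d_def by auto
  qed
  have cls: "?R `` {p} = {q \<in> carrier M \<times> carrier M. d q = d p}" if "p \<in> carrier M \<times> carrier M" for p
    using R that by auto
  have refl': "p \<in> ?R `` {p}" if "p \<in> carrier M \<times> carrier M" for p
    using R that by auto
  have mult: "?R `` {p} \<otimes>\<^bsub>?G\<^esub> ?R `` {q} = {r \<in> carrier M \<times> carrier M. d r = d p + d q}"
    if "p \<in> carrier M \<times> carrier M" "q \<in> carrier M \<times> carrier M" for p q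
  proof -
    have "(case p' of (a, b) \<Rightarrow> \<Union>(c, e)\<in>?R `` {q}. ?R `` {(a \<otimes>\<^bsub>M\<^esub> c, b \<otimes>\<^bsub>M\<^esub> e)})
        = {r \<in> carrier M \<times> carrier M. d r = d p + d q}" if "p' \<in> ?R `` {p}" for p'
    proof -
      obtain a b where p': "p' = (a, b)" by force
      have "(\<Union>q'\<in>?R `` {q}. case q' of (c, e) \<Rightarrow> ?R `` {(a \<otimes>\<^bsub>M\<^esub> c, b \<otimes>\<^bsub>M\<^esub> e)})
          = (\<Union>q'\<in>?R `` {q}. {r \<in> carrier M \<times> carrier M. d r = d p + d q})"
      proof (rule SUP_cong[OF refl])
        fix q' assume q': "q' \<in> ?R `` {q}"
        obtain c e where ce: "q' = (c, e)" by force
        have "a \<in> carrier M" "b \<in> carrier M" "c \<in> carrier M" "e \<in> carrier M"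
          and "d (a, b) = d p" "d (c, e) = d q"
          using that q' R unfolding p' ce by auto
        then show "(case q' of (c, e) \<Rightarrow> ?R `` {(a \<otimes>\<^bsub>M\<^esub> c, b \<otimes>\<^bsub>M\<^esub> e)})
            = {r \<in> carrier M \<times> carrier M. d r = d p + d q}"
          unfolding ce by (auto simp: cls closed d_def add)
      qed
      also have "\<dots> = {r \<in> carrier M \<times> carrier M. d r = d p + d q}"
        using refl'[OF \<open>q \<in> _\<close>] by auto
      finally show ?thesis unfolding p' by simp
    qed
    then have "(\<Union>p'\<in>?R `` {p}. case p' of (a, b) \<Rightarrow> \<Union>(c, e)\<in>?R `` {q}. ?R `` {(a \<otimes>\<^bsub>M\<^esub> c, b \<otimes>\<^bsub>M\<^esub> e)})
        = (\<Union>p'\<in>?R `` {p}. {r \<in> carrier M \<times> carrier M. d r = d p + d q})"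
      by (intro SUP_cong refl)
    also have "\<dots> = {r \<in> carrier M \<times> carrier M. d r = d p + d q}"
      using refl'[OF \<open>p \<in> _\<close>] by auto
    finally show ?thesis by (simp add: grothendieck_group_def)
  qed
  \<comment> \<open>The isomorphism starts from the integers and sends \<open>z\<close> to the fibre
    of \<open>d\<close> over \<open>z\<close>. Every fibre is a class, so no representatives have to
    be chosen.\<close>
  define \<psi> where "\<psi> z = {r \<in> carrier M \<times> carrier M. d r = z}" for z
  have surj: "\<exists>p \<in> carrier M \<times> carrier M. d p = z" for z
  proof -
    \<comment> \<open>At least one of \<open>nat z\<close> and \<open>nat (- z)\<close> is 0, and
      their difference is \<open>z\<close>.\<close>
    obtain a where a: "a \<in> carrier M" "f a = nat z" using bij by (metis UNIV_I bij_betwE bij_betw_imp_surj_on imageE)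
    obtain b where b: "b \<in> carrier M" "f b = nat (- z)" using bij by (metis UNIV_I bij_betwE bij_betw_imp_surj_on imageE)
    have "d (a, b) = z" using a b by (simp add: d_def)
    with a b show ?thesis by blast
  qed
  have \<psi>cls: "\<psi> (d p) = ?R `` {p}" if "p \<in> carrier M \<times> carrier M" for p
    using cls[OF that] by (simp add: \<psi>_def)
  have carr: "carrier ?G = range \<psi>"
  proof -
    have "carrier ?G = (\<lambda>p. \<psi> (d p)) ` (carrier M \<times> carrier M)"
      using \<psi>cls by (auto simp: grothendieck_group_def quotient_def)
    also have "\<dots> = range \<psi>" using surj by (auto simp: image_iff) metis
    finally show ?thesis .
  qed
  have "\<psi> \<in> iso integer_group ?G"
  proof (rule isoI)
    show "\<psi> \<in> hom integer_group ?G"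
    proof (rule homI)
      fix x y :: int
      obtain p q where pq: "p \<in> carrier M \<times> carrier M" "d p = x" "q \<in> carrier M \<times> carrier M" "d q = y"
        using surj by metis
      then show "\<psi> (x \<otimes>\<^bsub>integer_group\<^esub> y) = \<psi> x \<otimes>\<^bsub>?G\<^esub> \<psi> y"
        using mult[OF pq(1,3)] \<psi>cls[OF pq(1)] \<psi>cls[OF pq(3)]
        by (simp add: integer_group_def) (simp add: \<psi>_def)
    qed (simp add: carr)
    have "x = y" if "\<psi> x = \<psi> y" for x y
    proof -
      obtain p where "p \<in> \<psi> x" using surj[of x] unfolding \<psi>_def by auto
      with that show ?thesis unfolding \<psi>_def by auto
    qed
    then show "bij_betw \<psi> (carrier integer_group) (carrier ?G)"
      unfolding bij_betw_def carr by (auto simp: inj_on_def integer_group_def)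
  qed
  note iso = this
  have "\<psi> \<one>\<^bsub>integer_group\<^esub> = \<one>\<^bsub>?G\<^esub>"
    using \<psi>cls[of "(\<one>\<^bsub>M\<^esub>, \<one>\<^bsub>M\<^esub>)"] one by (simp add: integer_group_def grothendieck_group_def d_def)
  then have "?G\<lparr>one := \<psi> \<one>\<^bsub>integer_group\<^esub>\<rparr> = ?G" by simp
  moreover have comm: "comm_group integer_group"
    using abelian_integer_mod_group[of 0] by (simp add: integer_mod_group_def)
  ultimately show "comm_group ?G"
    using comm_group.iso_imp_img_comm_group[OF comm iso] by simp
  have "integer_group \<cong> ?G" using iso by (rule is_isoI)
  then show "?G \<cong> integer_group" by (rule group.iso_sym[OF group_integer_group])
qed

section \<open>Quotients of matrices under direct sum\<close>

declare diag_block_mat.simps [simp del]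

text \<open>A move applied to \<open>A \<boxplus> C\<close> appends its summand after
  \<open>C\<close>, while compatibility with sums asks for it directly after \<open>A\<close>; this
  conjugation relates the two places.\<close>

lemma similar_block_sum_right_commute:
  fixes A B C :: "complex mat"
  assumes "A \<in> carrier_mat n n" "B \<in> carrier_mat m m" "C \<in> carrier_mat k k"
  shows "similar_mat ((A \<boxplus> B) \<boxplus> C) ((A \<boxplus> C) \<boxplus> B)"
proof (subst similar_iff_jblocks)
  show "(A \<boxplus> B) \<boxplus> C \<in> carrier_mat (n + m + k) (n + m + k)"
    "(A \<boxplus> C) \<boxplus> B \<in> carrier_mat (n + k + m) (n + k + m)"
    using assms by (simp_all)
  show "jblocks ((A \<boxplus> B) \<boxplus> C) = jblocks ((A \<boxplus> C) \<boxplus> B)"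
    using assms by (simp add: jblocks_block_sum[of _ "n + m" _ k] jblocks_block_sum[of _ "n + k" _ m]
        jblocks_block_sum[of _ n])
qed

text \<open>The pattern common to \<open>K0\<close> and \<open>K1\<close>. In
  \<open>step_sum\<close> the two sums are linked by a chain of moves rather than by one, because an
  appended summand must still be conjugated into its place.\<close>

locale block_quotient =
  fixes S :: "complex mat set" and step :: "complex mat \<Rightarrow> complex mat \<Rightarrow> bool" and z :: "complex mat"
  assumes square: "A \<in> S \<Longrightarrow> \<exists>n. A \<in> carrier_mat n n"
    and step_closed: "step A B \<Longrightarrow> A \<in> S \<and> B \<in> S"
    and sum_closed: "A \<in> S \<Longrightarrow> B \<in> S \<Longrightarrow> A \<boxplus> B \<in> S"
    and step_similar: "A \<in> S \<Longrightarrow> similar_mat B A \<Longrightarrow> step A B"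
    and step_sum: "step A A' \<Longrightarrow> B \<in> S \<Longrightarrow> equivclp step (A \<boxplus> B) (A' \<boxplus> B)"
    and z_closed: "z \<in> S"
    and step_unit: "A \<in> S \<Longrightarrow> step A (A \<boxplus> z)"
begin

definition rel :: "(complex mat \<times> complex mat) set" where
  "rel = {(A, B). equivclp step A B}"

definition quot :: "complex mat set monoid" where
  "quot = \<lparr>carrier = S // rel,
      monoid.mult = (\<lambda>X Y. \<Union>A \<in> X. \<Union>B \<in> Y. rel `` {A \<boxplus> B}),
      monoid.one = rel `` {z}\<rparr>"

text \<open>The closure is reflexive on all matrices, hence \<open>UNIV\<close>; that classes of
  members of \<open>S\<close> stay inside \<open>S\<close> is \<open>rel_closed\<close>.\<close>

lemma equiv_rel: "equiv UNIV rel"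
  unfolding rel_def by (intro equivI refl_onI symI transI)
    (auto intro: equivclp_sym equivclp_trans)

lemma step_rel: "step A B \<Longrightarrow> (A, B) \<in> rel"
  unfolding rel_def by auto

lemma class_eq_iff: "rel `` {A} = rel `` {B} \<longleftrightarrow> (A, B) \<in> rel"
  using equiv_rel by (simp add: equiv_class_eq_iff)

lemma class_similar: "A \<in> S \<Longrightarrow> similar_mat B A \<Longrightarrow> rel `` {A} = rel `` {B}"
  unfolding class_eq_iff by (intro step_rel step_similar)

text \<open>The means of telling classes apart: what every single move preserves is constant on the
  equivalence closure.\<close>

lemma rel_invariant:
  assumes "\<And>A B. step A B \<Longrightarrow> f A = f B" "(A, B) \<in> rel"
  shows "f A = f B"
proof -
  have "equivclp step A B" using assms(2) unfolding rel_def by simp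
  then show ?thesis by (induction rule: equivclp_induct) (use assms(1) in fastforce)+
qed

lemma rel_closed:
  assumes "(A, B) \<in> rel" "A \<in> S"
  shows "B \<in> S"
  \<comment> \<open>Membership in \<open>S\<close> is itself an invariant, since both ends of a move
    lie in \<open>S\<close>.\<close>
  using rel_invariant[of "\<lambda>A. A \<in> S", OF _ assms(1)] step_closed assms(2) by blast

lemma rel_sum_left:
  assumes "(A, A') \<in> rel" "B \<in> S"
  shows "(A \<boxplus> B, A' \<boxplus> B) \<in> rel"
proof -
  have "equivclp step A A'" using assms(1) unfolding rel_def by simp
  then show ?thesis
  proof (induction rule: equivclp_induct)
    case base
    then show ?case using equiv_rel by (auto simp: rel_def)
  next
    case (step C D)
    then have "equivclp step (C \<boxplus> B) (D \<boxplus> B)"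
      using step_sum assms(2) equivclp_sym by metis
    with step show ?case unfolding rel_def by (auto intro: equivclp_trans)
  qed
qed

lemma class_sum_commute:
  assumes "A \<in> S" "B \<in> S"
  shows "rel `` {A \<boxplus> B} = rel `` {B \<boxplus> A}"
proof -
  obtain n m where "A \<in> carrier_mat n n" "B \<in> carrier_mat m m" using square assms by metis
  then show ?thesis using assms by (intro class_similar sum_closed similar_block_sum_swap)
qed

text \<open>\<open>rel_sum_left\<close> changes the left summand; the right one is changed by
  swapping the summands, replacing, and swapping back.\<close>

lemma class_sum_cong:
  assumes "(A, A') \<in> rel" "(B, B') \<in> rel" "A \<in> S" "B \<in> S"
  shows "rel `` {A \<boxplus> B} = rel `` {A' \<boxplus> B'}"
proof -
  have S: "A' \<in> S" "B' \<in> S" using rel_closed assms by auto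
  have "rel `` {A \<boxplus> B} = rel `` {A' \<boxplus> B}"
    unfolding class_eq_iff using assms by (intro rel_sum_left)
  also have "\<dots> = rel `` {B \<boxplus> A'}" using S assms by (intro class_sum_commute)
  also have "\<dots> = rel `` {B' \<boxplus> A'}"
    unfolding class_eq_iff using assms S by (intro rel_sum_left)
  also have "\<dots> = rel `` {A' \<boxplus> B'}" using S assms by (intro class_sum_commute)
  finally show ?thesis .
qed

lemma carrier_quot: "carrier quot = (\<lambda>A. rel `` {A}) ` S"
  unfolding quot_def quotient_def by auto

lemma one_quot: "\<one>\<^bsub>quot\<^esub> = rel `` {z}"
  by (simp add: quot_def)

lemma mult_quot:
  assumes "A \<in> S" "B \<in> S"
  shows "rel `` {A} \<otimes>\<^bsub>quot\<^esub> rel `` {B} = rel `` {A \<boxplus> B}"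
proof -
  have "A \<in> rel `` {A}" "B \<in> rel `` {B}" unfolding rel_def by auto
  moreover have "rel `` {A' \<boxplus> B'} = rel `` {A \<boxplus> B}" if "A' \<in> rel `` {A}" "B' \<in> rel `` {B}" for A' B'
    using class_sum_cong[of A A' B B'] that assms by simp
  ultimately have "(\<Union>A'\<in>rel `` {A}. \<Union>B'\<in>rel `` {B}. rel `` {A' \<boxplus> B'}) = rel `` {A \<boxplus> B}"
    by (intro UN2_const) blast+
  then show ?thesis by (simp add: quot_def)
qed

lemma comm_monoid_quot: "comm_monoid quot"
proof (rule comm_monoidI)
  fix x y w
  show "\<one>\<^bsub>quot\<^esub> \<in> carrier quot" using z_closed by (auto simp: carrier_quot one_quot)
  assume x: "x \<in> carrier quot"
  then obtain A where A: "A \<in> S" "x = rel `` {A}" by (auto simp: carrier_quot)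
  have "rel `` {z \<boxplus> A} = rel `` {A \<boxplus> z}" using class_sum_commute z_closed A by auto
  also have "\<dots> = rel `` {A}" using step_rel[OF step_unit[OF A(1)]] class_eq_iff by blast
  finally show "\<one>\<^bsub>quot\<^esub> \<otimes>\<^bsub>quot\<^esub> x = x"
    using mult_quot[OF z_closed A(1)] A by (simp add: one_quot)
  assume "y \<in> carrier quot"
  then obtain B where B: "B \<in> S" "y = rel `` {B}" by (auto simp: carrier_quot)
  show "x \<otimes>\<^bsub>quot\<^esub> y \<in> carrier quot"
    using A B mult_quot sum_closed by (auto simp: carrier_quot)
  show "x \<otimes>\<^bsub>quot\<^esub> y = y \<otimes>\<^bsub>quot\<^esub> x"
    using A B mult_quot class_sum_commute by simp
  assume "w \<in> carrier quot"
  then obtain C where C: "C \<in> S" "w = rel `` {C}" by (auto simp: carrier_quot)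
  show "x \<otimes>\<^bsub>quot\<^esub> y \<otimes>\<^bsub>quot\<^esub> w = x \<otimes>\<^bsub>quot\<^esub> (y \<otimes>\<^bsub>quot\<^esub> w)"
    using A B C by (simp add: mult_quot sum_closed block_sum_assoc)
qed

end

section \<open>Idempotent matrices\<close>

lemma idempotent_mats_block_sum:
  assumes "p \<in> idempotent_mats" "q \<in> idempotent_mats"
  shows "p \<boxplus> q \<in> idempotent_mats"
proof -
  obtain n m where p: "n \<ge> 1" "p \<in> carrier_mat n n" "p * p = p"
    and q: "q \<in> carrier_mat m m" "q * q = q"
    using assms unfolding idempotent_mats_def by auto
  have "(p \<boxplus> q) * (p \<boxplus> q) = p \<boxplus> q"
    unfolding block_sum_eq[OF p(2) q(1)]
    by (subst mult_four_block_mat[of _ n n _ m _ m _ _ n _ m]) (use p q in auto)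
  then show ?thesis unfolding idempotent_mats_def
    using p(1) block_sum_carrier[OF p(2) q(1)] by (intro CollectI exI[of _ "n + m"]) auto
qed

lemma zero_idempotent_mats: "k \<ge> 1 \<Longrightarrow> 0\<^sub>m k k \<in> idempotent_mats"
  unfolding idempotent_mats_def by auto

lemma one_idempotent_mats: "k \<ge> 1 \<Longrightarrow> 1\<^sub>m k \<in> idempotent_mats"
  unfolding idempotent_mats_def by auto

lemma idempotent_mats_similar:
  assumes "p \<in> idempotent_mats" "similar_mat q p"
  shows "q \<in> idempotent_mats"
proof -
  obtain n where "n \<ge> 1" "p \<in> carrier_mat n n" "p * p = p"
    using assms unfolding idempotent_mats_def by auto
  then show ?thesis
    using similar_mat_idempotent[OF assms(2)] similar_mat_square[OF similar_mat_sym[OF assms(2)]]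
    unfolding idempotent_mats_def by auto
qed

lemma K0_step_zero: "p \<in> idempotent_mats \<Longrightarrow> k \<ge> 1 \<Longrightarrow> K0_step p (p \<boxplus> 0\<^sub>m k k)"
  by (auto simp: K0_step_def)

lemma K0_step_similar: "p \<in> idempotent_mats \<Longrightarrow> similar_mat q p \<Longrightarrow> K0_step p q"
  by (auto simp: K0_step_def)

interpretation K0: block_quotient idempotent_mats K0_step "0\<^sub>m 1 1"
  rewrites "block_quotient.rel K0_step = K0_rel"
    and "block_quotient.quot idempotent_mats K0_step (0\<^sub>m 1 1) = idempotent_monoid"
proof -
  show *: "block_quotient idempotent_mats K0_step (0\<^sub>m 1 1)"
  proof
    fix A B C :: "complex mat"
    show "\<exists>n. A \<in> carrier_mat n n" if "A \<in> idempotent_mats"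
      using that unfolding idempotent_mats_def by auto
    show "A \<in> idempotent_mats \<and> B \<in> idempotent_mats" if "K0_step A B"
      using that idempotent_mats_block_sum zero_idempotent_mats idempotent_mats_similar
      unfolding K0_step_def by blast
    show "K0_step A B" if "A \<in> idempotent_mats" "similar_mat B A"
      using that unfolding K0_step_def by auto
    show "K0_step A (A \<boxplus> 0\<^sub>m 1 1)" if "A \<in> idempotent_mats"
      using that unfolding K0_step_def by auto
    show "equivclp K0_step (A \<boxplus> C) (B \<boxplus> C)" if st: "K0_step A B" and C: "C \<in> idempotent_mats"
    proof -
      have A: "A \<in> idempotent_mats" using st unfolding K0_step_def by simp
      have AC: "A \<boxplus> C \<in> idempotent_mats" using A C by (rule idempotent_mats_block_sum)
      obtain n m where nm: "A \<in> carrier_mat n n" "C \<in> carrier_mat m m"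
        using A C unfolding idempotent_mats_def by auto
      consider k where "k \<ge> 1" "B = A \<boxplus> 0\<^sub>m k k" | "similar_mat B A"
        using st unfolding K0_step_def by auto
      then show ?thesis
      proof cases
        case (1 k)
        have "K0_step (A \<boxplus> C) ((A \<boxplus> C) \<boxplus> 0\<^sub>m k k)"
          using AC 1(1) by (rule K0_step_zero)
        moreover have "K0_step ((A \<boxplus> C) \<boxplus> 0\<^sub>m k k) (B \<boxplus> C)"
          unfolding 1(2)
          by (intro K0_step_similar idempotent_mats_block_sum[OF AC zero_idempotent_mats[OF 1(1)]]
              similar_block_sum_right_commute[OF nm(1) zero_carrier_mat nm(2)])
        ultimately show ?thesis by (meson equivclp_trans r_into_equivclp)
      next
        case 2
        have "K0_step (A \<boxplus> C) (B \<boxplus> C)"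
          using AC by (rule K0_step_similar) (intro similar_block_sum 2 similar_mat_refl[OF nm(2)])
        then show ?thesis by blast
      qed
    qed
  qed (auto intro: idempotent_mats_block_sum zero_idempotent_mats)
  show "block_quotient.rel K0_step = K0_rel"
    unfolding block_quotient.rel_def[OF *] K0_rel_def ..
  then show "block_quotient.quot idempotent_mats K0_step (0\<^sub>m 1 1) = idempotent_monoid"
    unfolding block_quotient.quot_def[OF *] idempotent_monoid_def by simp
qed

lemma idempotent_jblocks:
  assumes "p \<in> idempotent_mats"
  shows "jblocks p = replicate_mset (count (jblocks p) (1, 1)) (1, 1)
    + replicate_mset (count (jblocks p) (1, 0)) (1, 0)"
proof (rule multiset_eqI)
  fix x
  obtain n where "p \<in> carrier_mat n n" "p * p = p" using assms unfolding idempotent_mats_def by auto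
  from jblocks_idempotent[OF this] show "count (jblocks p) x =
      count (replicate_mset (count (jblocks p) (1, 1)) (1, 1)
        + replicate_mset (count (jblocks p) (1, 0)) (1, 0)) x"
    by (cases "x \<in># jblocks p") (auto simp: not_in_iff)
qed

text \<open>The multiplicity of the Jordan block \<open>1\<close> of an idempotent is its rank.\<close>

lemma K0_rel_iff_rank:
  assumes p: "p \<in> idempotent_mats" and q: "q \<in> idempotent_mats"
  shows "(p, q) \<in> K0_rel \<longleftrightarrow> count (jblocks p) (1, 1) = count (jblocks q) (1, 1)"
proof
  have "count (jblocks A) (1, 1) = count (jblocks B) (1, 1)" if st: "K0_step A B" for A B
  proof -
    obtain n where A: "A \<in> carrier_mat n n"
      using st unfolding K0_step_def idempotent_mats_def by auto
    consider k where "B = A \<boxplus> 0\<^sub>m k k" | "similar_mat B A"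
      using st unfolding K0_step_def by auto
    then show ?thesis
    proof cases
      case (1 k)
      show ?thesis
        unfolding 1 jblocks_block_sum[OF A zero_carrier_mat] by (simp add: jblocks_zero)
    next
      case 2
      then show ?thesis using jblocks_similar by simp
    qed
  qed
  then show "(p, q) \<in> K0_rel \<Longrightarrow> count (jblocks p) (1, 1) = count (jblocks q) (1, 1)"
    by (rule K0.rel_invariant)
next
  assume eq: "count (jblocks p) (1, 1) = count (jblocks q) (1, 1)"
  \<comment> \<open>Each matrix receives the zero blocks of the other one, so that both totals
    agree; the successor is there because stabilisation adds a zero matrix of size at least
    1.\<close>
  define s t where "s = Suc (count (jblocks q) (1, 0))" "t = Suc (count (jblocks p) (1, 0))"
  obtain n m where nm: "p \<in> carrier_mat n n" "q \<in> carrier_mat m m"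
    using p q unfolding idempotent_mats_def by auto
  have C: "p \<boxplus> 0\<^sub>m s s \<in> carrier_mat (n + s) (n + s)" "q \<boxplus> 0\<^sub>m t t \<in> carrier_mat (m + t) (m + t)"
    using nm by (simp_all)
  have "jblocks (p \<boxplus> 0\<^sub>m s s) = jblocks (q \<boxplus> 0\<^sub>m t t)"
    unfolding jblocks_block_sum[OF nm(1) zero_carrier_mat] jblocks_block_sum[OF nm(2) zero_carrier_mat]
      jblocks_zero
    by (subst idempotent_jblocks[OF p], subst idempotent_jblocks[OF q])
      (use eq in \<open>auto simp: s_t_def multiset_eq_iff\<close>)
  then have "similar_mat (q \<boxplus> 0\<^sub>m t t) (p \<boxplus> 0\<^sub>m s s)" using similar_iff_jblocks C by metis
  moreover have st: "s \<ge> 1" "t \<ge> 1" by (auto simp: s_t_def)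
  ultimately have "K0_rel `` {p \<boxplus> 0\<^sub>m s s} = K0_rel `` {q \<boxplus> 0\<^sub>m t t}"
    using p by (intro K0.class_similar idempotent_mats_block_sum zero_idempotent_mats)
  moreover have "(p, p \<boxplus> 0\<^sub>m s s) \<in> K0_rel" "(q, q \<boxplus> 0\<^sub>m t t) \<in> K0_rel"
    using p q st by (auto intro!: K0.step_rel K0_step_zero)
  ultimately have "K0_rel `` {p} = K0_rel `` {q}" using K0.class_eq_iff by metis
  then show "(p, q) \<in> K0_rel" using K0.class_eq_iff by metis
qed

lemma K0_integers: "comm_group K0" "K0 \<cong> integer_group"
proof -
  \<comment> \<open>The rank of a chosen representative; \<open>K0_rel_iff_rank\<close> makes it
    independent of the choice and injective on classes.\<close>
  define f where "f X = count (jblocks (SOME p. p \<in> idempotent_mats \<and> X = K0_rel `` {p})) (1, 1)" for X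
  have f: "f (K0_rel `` {p}) = count (jblocks p) (1, 1)" if "p \<in> idempotent_mats" for p
  proof -
    define q where "q = (SOME q. q \<in> idempotent_mats \<and> K0_rel `` {p} = K0_rel `` {q})"
    have "q \<in> idempotent_mats \<and> K0_rel `` {p} = K0_rel `` {q}"
      unfolding q_def by (rule someI[of _ p]) (simp add: that)
    then show ?thesis
      using K0_rel_iff_rank[OF that, of q] K0.class_eq_iff[of p q] unfolding f_def q_def by simp
  qed
  interpret comm_monoid idempotent_monoid by (rule K0.comm_monoid_quot)
  have bij: "bij_betw f (carrier idempotent_monoid) UNIV"
    unfolding bij_betw_def
  proof
    show "inj_on f (carrier idempotent_monoid)"
      unfolding K0.carrier_quot inj_on_def using f K0_rel_iff_rank K0.class_eq_iff by auto
    have "k \<in> f ` carrier idempotent_monoid" for k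
    \<comment> \<open>Idempotents have size at least 1, so rank 0 is realised by the zero matrix of
      size 1 instead of an empty identity matrix.\<close>
    proof (cases "k = 0")
      case True
      then have "k = f (K0_rel `` {0\<^sub>m 1 1})"
        using f[OF zero_idempotent_mats[of 1]] by (simp add: jblocks_zero)
      then show ?thesis unfolding K0.carrier_quot using zero_idempotent_mats[of 1] by blast
    next
      case False
      then have "1\<^sub>m k \<in> idempotent_mats" using one_idempotent_mats by simp
      moreover from this have "k = f (K0_rel `` {1\<^sub>m k})" using f by (simp add: jblocks_one)
      ultimately show ?thesis unfolding K0.carrier_quot by blast
    qed
    then show "f ` carrier idempotent_monoid = UNIV" by auto
  qed
  have add: "f (x \<otimes>\<^bsub>idempotent_monoid\<^esub> y) = f x + f y"
    if xy: "x \<in> carrier idempotent_monoid" "y \<in> carrier idempotent_monoid" for x y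
  proof -
    obtain p q where pq: "p \<in> idempotent_mats" "q \<in> idempotent_mats"
      "x = K0_rel `` {p}" "y = K0_rel `` {q}"
      using xy unfolding K0.carrier_quot by auto
    obtain n m where nm: "p \<in> carrier_mat n n" "q \<in> carrier_mat m m"
      using pq unfolding idempotent_mats_def by auto
    show ?thesis
      unfolding pq(3,4) K0.mult_quot[OF pq(1,2)] f[OF pq(1)] f[OF pq(2)]
        f[OF idempotent_mats_block_sum[OF pq(1,2)]] jblocks_block_sum[OF nm] by simp
  qed
  have one: "f \<one>\<^bsub>idempotent_monoid\<^esub> = 0"
    unfolding K0.one_quot using f[OF zero_idempotent_mats[of 1]] by (simp add: jblocks_zero)
  show "comm_group K0" "K0 \<cong> integer_group"
    unfolding K0_def using grothendieck_group_nat[OF bij m_closed add one_closed one] by blast+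
qed

section \<open>Invertible matrices\<close>

lemma inverse_mat_ex:
  fixes A :: "complex mat"
  assumes A: "A \<in> carrier_mat n n" and "det A \<noteq> 0"
  obtains B where "B \<in> carrier_mat n n" "A * B = 1\<^sub>m n" "B * A = 1\<^sub>m n"
proof -
  have "A \<in> Units (ring_mat TYPE(complex) n ())" using assms by (rule det_non_zero_imp_unit)
  then have "\<exists>B \<in> carrier_mat n n. B * A = 1\<^sub>m n \<and> A * B = 1\<^sub>m n"
    unfolding Units_def ring_mat_def by simp
  then show ?thesis using that by auto
qed

text \<open>Determinants are multiplicative on direct sums and invariant under conjugation, which
  gives the closure properties of \<open>GL_mats\<close> at once.\<close>

lemma GL_mats_iff: "A \<in> GL_mats \<longleftrightarrow> (\<exists>n \<ge> 1. A \<in> carrier_mat n n \<and> det A \<noteq> 0)"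
proof
  assume "A \<in> GL_mats"
  then obtain n B where n: "n \<ge> 1" and A: "A \<in> carrier_mat n n"
    and AB: "A * B = 1\<^sub>m n" and BA: "B * A = 1\<^sub>m (dim_row B)"
    unfolding GL_mats_def invertible_mat_def inverts_mat_def by auto
  \<comment> \<open>Invertibility does not fix the size of \<open>B\<close>; it is read off from the
    two identity matrices.\<close>
  have "dim_col B = n" "dim_row B = n"
    using arg_cong[OF AB, of dim_col] arg_cong[OF BA, of dim_col] A by auto
  then have "B \<in> carrier_mat n n" by auto
  then have "det A * det B = 1" using det_mult[OF A, of B] AB by simp
  then show "\<exists>n \<ge> 1. A \<in> carrier_mat n n \<and> det A \<noteq> 0" using n A by auto
next
  assume "\<exists>n \<ge> 1. A \<in> carrier_mat n n \<and> det A \<noteq> 0"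
  then obtain n where n: "n \<ge> 1" and A: "A \<in> carrier_mat n n" and "det A \<noteq> 0" by auto
  then obtain B where "B \<in> carrier_mat n n" "B * A = 1\<^sub>m n" "A * B = 1\<^sub>m n"
    using inverse_mat_ex[OF A] by metis
  then show "A \<in> GL_mats"
    using n A unfolding GL_mats_def invertible_mat_def inverts_mat_def by auto
qed

lemma GL_mats_block_sum:
  assumes "u \<in> GL_mats" "v \<in> GL_mats"
  shows "u \<boxplus> v \<in> GL_mats"
proof -
  obtain n m where u: "n \<ge> 1" "u \<in> carrier_mat n n" "det u \<noteq> 0"
    and v: "v \<in> carrier_mat m m" "det v \<noteq> 0"
    using assms unfolding GL_mats_iff by auto
  have "det (u \<boxplus> v) \<noteq> 0" unfolding det_block_sum[OF u(2) v(1)] using u v by simp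
  moreover have "n + m \<ge> 1" using u by simp
  ultimately show ?thesis
    unfolding GL_mats_iff using block_sum_carrier[OF u(2) v(1)] by blast
qed

lemma GL_mats_similar:
  assumes "u \<in> GL_mats" "similar_mat v u"
  shows "v \<in> GL_mats"
proof -
  obtain n where "n \<ge> 1" "u \<in> carrier_mat n n" "det u \<noteq> 0"
    using assms unfolding GL_mats_iff by auto
  then show ?thesis
    using det_similar[OF assms(2)] similar_mat_square[OF similar_mat_sym[OF assms(2)]]
    unfolding GL_mats_iff by auto
qed

lemma GL_mats_one: "1\<^sub>m 1 \<in> GL_mats"
  unfolding GL_mats_iff by (intro exI[of _ 1]) auto

lemma GL_mats_jordan_matrix:
  assumes "xs \<noteq> []" "0 \<notin> fst ` set xs" "0 \<notin> snd ` set xs"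
  shows "jordan_matrix xs \<in> GL_mats"
proof -
  have "det (jordan_matrix xs) \<noteq> 0"
    unfolding det_jordan_matrix using assms by (force simp: prod_list_zero_iff)
  moreover have "sum_list (map fst xs) \<ge> 1"
    using assms by (cases xs) (auto simp: Suc_le_eq)
  ultimately show ?thesis unfolding GL_mats_iff using jordan_matrix_carrier by blast
qed

lemma GL_mats_jordan_block: "n \<ge> 1 \<Longrightarrow> a \<noteq> 0 \<Longrightarrow> jordan_block n a \<in> GL_mats"
  using GL_mats_jordan_matrix[of "[(n, a)]"] by (simp add: jordan_matrix_singleton)

lemma GL_mats_square: "u \<in> GL_mats \<Longrightarrow> \<exists>n. u \<in> carrier_mat n n"
  unfolding GL_mats_iff by auto

lemma GL_mats_diag_block_mat:
  "As \<noteq> [] \<Longrightarrow> set As \<subseteq> GL_mats \<Longrightarrow> diag_block_mat As \<in> GL_mats"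
proof (induction As rule: list_nonempty_induct)
  case (single A)
  then show ?case by simp
next
  case (cons A As)
  then show ?case unfolding block_sum_Cons[of A As] by (intro GL_mats_block_sum) auto
qed

lemma jblocks_diag_block_mat:
  assumes "\<And>A. A \<in> set As \<Longrightarrow> \<exists>n. A \<in> carrier_mat n n"
  shows "(\<exists>n. diag_block_mat As \<in> carrier_mat n n)
    \<and> jblocks (diag_block_mat As) = sum_list (map jblocks As)"
  using assms
proof (induction As)
  case Nil
  have "\<exists>n. (0\<^sub>m 0 0 :: complex mat) \<in> carrier_mat n n" by (rule exI[of _ 0]) simp
  then show ?case using jblocks_zero[of 0] unfolding diag_block_mat.simps(1) by simp
next
  case (Cons A As)
  obtain n where n: "A \<in> carrier_mat n n" using Cons.prems by auto
  obtain m where m: "diag_block_mat As \<in> carrier_mat m m" using Cons by auto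
  show ?case
    unfolding block_sum_Cons[of A As] jblocks_block_sum[OF n m] using Cons block_sum_carrier[OF n m] by auto
qed

definition inverse_pair :: "complex mat \<Rightarrow> complex mat \<Rightarrow> bool" where
  "inverse_pair v w \<longleftrightarrow> v \<in> GL_mats \<and> w \<in> GL_mats \<and> inverts_mat v w \<and> inverts_mat w v"

lemma inverse_pairE:
  assumes "inverse_pair v w"
  obtains n where "n \<ge> 1" "v \<in> carrier_mat n n" "w \<in> carrier_mat n n" "v * w = 1\<^sub>m n" "w * v = 1\<^sub>m n"
proof -
  obtain n m where n: "n \<ge> 1" "v \<in> carrier_mat n n" and m: "w \<in> carrier_mat m m"
    using assms unfolding inverse_pair_def GL_mats_iff by auto
  have vw: "v * w = 1\<^sub>m n" "w * v = 1\<^sub>m m"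
    using assms n m unfolding inverse_pair_def inverts_mat_def by auto
  have "m = n" using arg_cong[OF vw(1), of dim_col] m by simp
  with n m vw that show ?thesis by simp
qed

lemma GL_mats_inverse:
  assumes "v \<in> GL_mats"
  obtains w where "inverse_pair v w"
proof -
  obtain n where n: "n \<ge> 1" and v: "v \<in> carrier_mat n n" "det v \<noteq> 0"
    using assms unfolding GL_mats_iff by auto
  obtain w where w: "w \<in> carrier_mat n n" "w * v = 1\<^sub>m n" "v * w = 1\<^sub>m n"
    using inverse_mat_ex[OF v] by metis
  have "w \<in> GL_mats"
    using n v w unfolding GL_mats_def invertible_mat_def inverts_mat_def by auto
  then have "inverse_pair v w"
    using assms v w unfolding inverse_pair_def inverts_mat_def by auto
  then show ?thesis by (rule that)
qed

lemma O_mats_alt: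
  "O_mats = {diag_block_mat (map (\<lambda>(v, w). v \<boxplus> w) vs) | vs.
     vs \<noteq> [] \<and> (\<forall>(v, w) \<in> set vs. inverse_pair v w)}"
  unfolding O_mats_def inverse_pair_def ..

lemma O_mats_GL:
  assumes "\<xi> \<in> O_mats"
  shows "\<xi> \<in> GL_mats"
proof -
  obtain vs where vs: "\<xi> = diag_block_mat (map (\<lambda>(v, w). v \<boxplus> w) vs)" "vs \<noteq> []"
    "\<And>v w. (v, w) \<in> set vs \<Longrightarrow> inverse_pair v w"
    using assms unfolding O_mats_alt by auto
  have "v \<boxplus> w \<in> GL_mats" if "(v, w) \<in> set vs" for v w
    using vs(3)[OF that] by (intro GL_mats_block_sum) (auto simp: inverse_pair_def)
  then show ?thesis unfolding vs(1) using vs(2) by (intro GL_mats_diag_block_mat) auto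
qed

lemma O_mats_pair:
  assumes "inverse_pair v w"
  shows "v \<boxplus> w \<in> O_mats"
  unfolding O_mats_alt using assms
  by (intro CollectI exI[of _ "[(v, w)]"]) simp

lemma K1_step_one: "u \<in> GL_mats \<Longrightarrow> K1_step u (u \<boxplus> 1\<^sub>m 1)"
  by (simp add: K1_step_def)

lemma K1_step_similar: "u \<in> GL_mats \<Longrightarrow> similar_mat v u \<Longrightarrow> K1_step u v"
  by (simp add: K1_step_def)

lemma K1_step_O: "u \<in> GL_mats \<Longrightarrow> \<xi> \<in> O_mats \<Longrightarrow> K1_step u (u \<boxplus> \<xi>)"
  by (auto simp: K1_step_def)

text \<open>Stabilisation and the addition of a member of \<open>O_mats\<close> both append an
  invertible summand, and are treated as one case.\<close>

lemma K1_step_cases: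
  assumes "K1_step u v"
  obtains "u \<in> GL_mats" "similar_mat v u"
  | \<xi> where "u \<in> GL_mats" "\<xi> = 1\<^sub>m 1 \<or> \<xi> \<in> O_mats" "v = u \<boxplus> \<xi>"
  using assms unfolding K1_step_def by blast

interpretation K1: block_quotient GL_mats K1_step "1\<^sub>m 1"
  rewrites "block_quotient.rel K1_step = K1_rel"
    and "block_quotient.quot GL_mats K1_step (1\<^sub>m 1) = K1"
proof -
  show *: "block_quotient GL_mats K1_step (1\<^sub>m 1)"
  proof
    fix A B C :: "complex mat"
    show "A \<in> GL_mats \<and> B \<in> GL_mats" if "K1_step A B"
      using that by (cases rule: K1_step_cases)
        (auto intro: GL_mats_similar GL_mats_block_sum GL_mats_one O_mats_GL simp del: One_nat_def)
    show "equivclp K1_step (A \<boxplus> C) (B \<boxplus> C)" if st: "K1_step A B" and C: "C \<in> GL_mats"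
    proof -
      have A: "A \<in> GL_mats" using st unfolding K1_step_def by simp
      have AC: "A \<boxplus> C \<in> GL_mats" using A C by (rule GL_mats_block_sum)
      obtain n m where nm: "A \<in> carrier_mat n n" "C \<in> carrier_mat m m"
        using GL_mats_square A C by metis
      from st show ?thesis
      proof (cases rule: K1_step_cases)
        case 1
        have "K1_step (A \<boxplus> C) (B \<boxplus> C)"
          using AC by (rule K1_step_similar) (intro similar_block_sum 1 similar_mat_refl[OF nm(2)])
        then show ?thesis by blast
      next
        case (2 \<xi>)
        have \<xi>: "\<xi> \<in> GL_mats" using 2(2) GL_mats_one O_mats_GL by auto
        obtain k where k: "\<xi> \<in> carrier_mat k k" using GL_mats_square[OF \<xi>] by auto
        have "K1_step (A \<boxplus> C) ((A \<boxplus> C) \<boxplus> \<xi>)"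
          using 2(2) K1_step_one[OF AC] K1_step_O[OF AC] by auto
        moreover have "K1_step ((A \<boxplus> C) \<boxplus> \<xi>) (B \<boxplus> C)"
          unfolding 2(3)
          by (intro K1_step_similar GL_mats_block_sum[OF AC \<xi>]
              similar_block_sum_right_commute[OF nm(1) k nm(2)])
        ultimately show ?thesis by (meson equivclp_trans r_into_equivclp)
      qed
    qed
  qed (auto intro: GL_mats_square GL_mats_block_sum GL_mats_one K1_step_one K1_step_similar
      simp del: One_nat_def)
  show "block_quotient.rel K1_step = K1_rel"
    unfolding block_quotient.rel_def[OF *] K1_rel_def ..
  then show "block_quotient.quot GL_mats K1_step (1\<^sub>m 1) = K1"
    unfolding block_quotient.quot_def[OF *] K1_def by simp
qed

text \<open>A move can only append \<open>v \<boxplus> w\<close> to a matrix at hand, here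
  \<open>1\<^sub>m 1\<close>; after a swap of summands the result is a stabilisation of
  \<open>v \<boxplus> w\<close>.\<close>

lemma K1_rel_inverse_pair:
  assumes "inverse_pair v w"
  shows "K1_rel `` {v \<boxplus> w} = K1_rel `` {1\<^sub>m 1}"
proof -
  have vw: "v \<boxplus> w \<in> GL_mats" using O_mats_GL[OF O_mats_pair[OF assms]] .
  have "K1_rel `` {1\<^sub>m 1} = K1_rel `` {1\<^sub>m 1 \<boxplus> (v \<boxplus> w)}"
    unfolding K1.class_eq_iff by (intro K1.step_rel K1_step_O GL_mats_one O_mats_pair assms)
  also have "\<dots> = K1_rel `` {(v \<boxplus> w) \<boxplus> 1\<^sub>m 1}"
    by (intro K1.class_sum_commute GL_mats_one vw)
  also have "\<dots> = K1_rel `` {v \<boxplus> w}"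
    using K1.step_rel[OF K1_step_one[OF vw]] K1.class_eq_iff by metis
  finally show ?thesis ..
qed

lemma comm_group_K1: "comm_group K1"
proof -
  interpret comm_monoid K1 by (rule K1.comm_monoid_quot)
  have "group K1"
  proof (rule group_l_invI)
    fix x assume "x \<in> carrier K1"
    then obtain v where v: "v \<in> GL_mats" "x = K1_rel `` {v}" unfolding K1.carrier_quot by auto
    obtain w where w: "inverse_pair v w" using GL_mats_inverse[OF v(1)] .
    then have w': "w \<in> GL_mats" "inverse_pair w v" by (auto simp: inverse_pair_def)
    have "K1_rel `` {w} \<otimes>\<^bsub>K1\<^esub> x = \<one>\<^bsub>K1\<^esub>"
      unfolding v(2) K1.mult_quot[OF w'(1) v(1)] K1.one_quot by (rule K1_rel_inverse_pair[OF w'(2)])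
    then show "\<exists>y\<in>carrier K1. y \<otimes>\<^bsub>K1\<^esub> x = \<one>\<^bsub>K1\<^esub>"
      unfolding K1.carrier_quot using w'(1) by blast
  qed
  then show ?thesis by (simp add: comm_group_def comm_monoid_axioms)
qed

section \<open>Classes in \<open>K1_loc\<close>\<close>

lemma comm_group_K1_loc: "comm_group K1_loc"
  unfolding K1_loc_def by (intro comm_group_projective_limit_const comm_group_K1)

lemma K1_class_eq_iff: "K1_class u = K1_class v \<longleftrightarrow> (u, v) \<in> K1_rel"
  unfolding K1_class_def K1.class_eq_iff[symmetric] by (simp add: fun_eq_iff)

lemma K1_class_similar: "u \<in> GL_mats \<Longrightarrow> similar_mat v u \<Longrightarrow> K1_class u = K1_class v"
  unfolding K1_class_eq_iff by (intro K1.step_rel K1_step_similar)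

lemma carrier_K1_loc: "carrier K1_loc = K1_class ` GL_mats"
  unfolding K1_loc_def carrier_projective_limit_const K1.carrier_quot image_image
  by (simp add: K1_class_def[abs_def])

lemma mult_K1_loc:
  "u \<in> GL_mats \<Longrightarrow> v \<in> GL_mats \<Longrightarrow> K1_class u \<otimes>\<^bsub>K1_loc\<^esub> K1_class v = K1_class (u \<boxplus> v)"
  unfolding K1_loc_def mult_projective_limit by (simp add: K1_class_def K1.mult_quot)

lemma one_K1_loc: "\<one>\<^bsub>K1_loc\<^esub> = K1_class (1\<^sub>m 1)"
  unfolding K1_loc_def one_projective_limit K1.one_quot by (simp add: K1_class_def)

lemma K1_class_closed: "u \<in> GL_mats \<Longrightarrow> K1_class u \<in> carrier K1_loc"
  unfolding carrier_K1_loc by blast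

text \<open>The inverse matrix of a Jordan block has a single block, of the same size and with
  inverse eigenvalue, so it is conjugate to that block. The relations of the theorem follow, as does
  order 2 when \<open>inverse a = a\<close>.\<close>

lemma K1_class_jordan_block_inverse:
  assumes "n \<ge> 1" "a \<noteq> 0"
  shows "K1_class (jordan_block n (inverse a)) = inv\<^bsub>K1_loc\<^esub> K1_class (jordan_block n a)"
proof -
  interpret comm_group K1_loc by (rule comm_group_K1_loc)
  let ?J = "jordan_block n a" and ?J' = "jordan_block n (inverse a)"
  have J: "?J \<in> GL_mats" "?J' \<in> GL_mats" using assms by (auto intro: GL_mats_jordan_block)
  obtain w where w: "inverse_pair ?J w" using GL_mats_inverse[OF J(1)] .
  then have wGL: "w \<in> GL_mats" and wJ: "inverse_pair w ?J" by (auto simp: inverse_pair_def)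
  from w obtain m where m: "?J \<in> carrier_mat m m" "w \<in> carrier_mat m m" "?J * w = 1\<^sub>m m" "w * ?J = 1\<^sub>m m"
    by (rule inverse_pairE)
  have "m = n" using carrier_matD(1)[OF m(1)] carrier_matD(1)[OF jordan_block_carrier[of n a]] by simp
  with m have "jblocks w = jblocks ?J'"
    using jblocks_jordan_block_inverse[of w n a] assms jblocks_jordan_block by simp
  then have "similar_mat w ?J'" using similar_iff_jblocks[OF m(2) jordan_block_carrier] by blast
  then have "K1_class ?J' = K1_class w" using K1_class_similar[OF J(2)] by blast
  moreover have "K1_class w \<otimes>\<^bsub>K1_loc\<^esub> K1_class ?J = \<one>\<^bsub>K1_loc\<^esub>"
    unfolding mult_K1_loc[OF wGL J(1)] one_K1_loc K1_class_eq_iff K1.class_eq_iff[symmetric]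
    by (rule K1_rel_inverse_pair[OF wJ])
  ultimately show ?thesis
    using inv_equality K1_class_closed J by metis
qed

section \<open>Charges: invariants dual to the generators\<close>

lemma equiv_inv_rel: "equiv C_bar inv_rel"
  by (intro equivI refl_onI symI transI) (auto simp: inv_rel_def)

lemma C_hat_cases:
  assumes "a \<noteq> 0" "a \<noteq> 1" "a \<noteq> -1" "\<And>c. c \<in> C_hat \<Longrightarrow> rep c \<in> c"
  obtains c where "c \<in> C_hat" "rep c = a \<or> rep c = inverse a"
proof
  have a: "a \<in> C_bar" using assms(1-3) by (simp add: C_bar_def)
  then show c: "inv_rel `` {a} \<in> C_hat" unfolding C_hat_def by (rule quotientI)
  show "rep (inv_rel `` {a}) = a \<or> rep (inv_rel `` {a}) = inverse a"
    using assms(4)[OF c] by (auto simp: inv_rel_def)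
qed

text \<open>Values stay in the integers, so that charges are additive in the multiset; the first two
  become invariants only after reduction modulo 2 in \<open>K1_charge\<close>. The third changes
  sign when all eigenvalues are inverted.\<close>

fun charge :: "(complex set \<Rightarrow> complex) \<Rightarrow> jordan_index \<Rightarrow> (nat \<times> complex) multiset \<Rightarrow> int" where
  "charge rep (Minus n) M = int (count M (n, -1))"
| "charge rep (Plus n) M = int (count M (n, 1))"
| "charge rep (Hat n c) M = int (count M (n, rep c)) - int (count M (n, inverse (rep c)))"

text \<open>Order \<open>0\<close> stands for an infinite cyclic factor: \<open>integer_mod_group 0\<close> is the group of integers.\<close>

fun index_order :: "jordan_index \<Rightarrow> nat" where
  "index_order (Minus n) = 2"
| "index_order (Plus n) = 2"
| "index_order (Hat n c) = 0"

lemma charge_add: "charge rep i (M + N) = charge rep i M + charge rep i N"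
  by (cases i) auto

lemma charge_empty: "charge rep i {#} = 0"
  by (cases i) auto

locale jordan_reps =
  fixes rep :: "complex set \<Rightarrow> complex"
  assumes rep: "c \<in> C_hat \<Longrightarrow> rep c \<in> c"
begin

lemma rep_C_bar: "c \<in> C_hat \<Longrightarrow> rep c \<in> C_bar"
  using rep in_quotient_imp_subset[OF equiv_inv_rel] unfolding C_hat_def by blast

lemma rep_neq: "c \<in> C_hat \<Longrightarrow> rep c \<noteq> 0 \<and> rep c \<noteq> 1 \<and> rep c \<noteq> -1"
  using rep_C_bar[of c] by (simp add: C_bar_def)

lemma rep_eq_iff:
  assumes "c \<in> C_hat" "c' \<in> C_hat"
  shows "c = c' \<longleftrightarrow> rep c = rep c' \<or> rep c = inverse (rep c')"
proof -
  have "c = c' \<longleftrightarrow> (rep c, rep c') \<in> inv_rel"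
    using quotient_eq_iff[OF equiv_inv_rel] assms rep unfolding C_hat_def by blast
  then show ?thesis using rep_C_bar assms by (auto simp: inv_rel_def)
qed

text \<open>A fixed point of inversion squares to 1, which \<open>C_bar\<close> excludes. Otherwise
  the two counts of a \<open>Hat\<close> charge would cancel on its own generator.\<close>

lemma rep_neq_inverse:
  assumes "c \<in> C_hat"
  shows "rep c \<noteq> inverse (rep c)"
proof
  assume "rep c = inverse (rep c)"
  then have "rep c * rep c = 1" using rep_neq[OF assms] by (metis right_inverse)
  then have "(rep c - 1) * (rep c + 1) = 0" by (simp add: algebra_simps)
  then have "rep c = 1 \<or> rep c = -1" by (simp add: eq_neg_iff_add_eq_0)
  then show False using rep_neq[OF assms] by blast
qed

lemma inverse_rep_neq:
  assumes "c \<in> C_hat"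
  shows "inverse (rep c) \<noteq> 1 \<and> inverse (rep c) \<noteq> -1"
proof -
  have "inverse (rep c) \<noteq> inverse 1" "inverse (rep c) \<noteq> inverse (-1)"
    unfolding inverse_eq_iff_eq using rep_neq[OF assms] by auto
  then show ?thesis by simp
qed

text \<open>The block \<open>(1, 1)\<close> would be counted by \<open>Plus 1\<close> alone, and the
  indices \<open>Plus n\<close> begin at 2.\<close>

lemma charge_one:
  assumes "i \<in> jordan_indices"
  shows "charge rep i (jblocks (1\<^sub>m 1)) = 0"
  using assms rep_neq by (auto simp: jordan_indices_def jblocks_one)

text \<open>At the eigenvalues 1 and -1 the counts of \<open>v\<close> and \<open>w\<close> agree
  and add up to an even number. In a \<open>Hat\<close> charge they cancel, which is what
  divisibility by 0 says.\<close>

lemma charge_inverse_pair: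
  assumes i: "i \<in> jordan_indices" and vw: "inverse_pair v w"
  shows "int (index_order i) dvd charge rep i (jblocks (v \<boxplus> w))"
proof -
  obtain n where n: "v \<in> carrier_mat n n" "w \<in> carrier_mat n n" "v * w = 1\<^sub>m n" "w * v = 1\<^sub>m n"
    using vw by (rule inverse_pairE)
  have inv: "count (jblocks w) (k, inverse a) = count (jblocks v) (k, a)" if "a \<noteq> 0" for a k
    using count_jblocks_inverse[OF n that] .
  show ?thesis
    unfolding jblocks_block_sum[OF n(1,2)]
  proof (cases i)
    case (Minus k)
    then show "int (index_order i) dvd charge rep i (jblocks v + jblocks w)"
      using inv[of "-1" k] by simp
  next
    case (Plus k)
    then show "int (index_order i) dvd charge rep i (jblocks v + jblocks w)"
      using inv[of 1 k] by simp
  next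
    case (Hat k c)
    then have "rep c \<noteq> 0" using i rep_neq by (auto simp: jordan_indices_def)
    then show "int (index_order i) dvd charge rep i (jblocks v + jblocks w)"
      using Hat inv[of "rep c" k] inv[of "inverse (rep c)" k] by simp
  qed
qed

lemma charge_O_mats:
  assumes i: "i \<in> jordan_indices" and "\<xi> \<in> O_mats"
  shows "int (index_order i) dvd charge rep i (jblocks \<xi>)"
proof -
  obtain vs where vs: "\<xi> = diag_block_mat (map (\<lambda>(v, w). v \<boxplus> w) vs)"
    "\<And>v w. (v, w) \<in> set vs \<Longrightarrow> inverse_pair v w"
    using assms(2) unfolding O_mats_alt by auto
  have sq: "\<exists>n. A \<in> carrier_mat n n" if "A \<in> set (map (\<lambda>(v, w). v \<boxplus> w) vs)" for A
    using that vs(2) O_mats_pair O_mats_GL GL_mats_square by fastforce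
  have "jblocks \<xi> = sum_list (map jblocks (map (\<lambda>(v, w). v \<boxplus> w) vs))"
    unfolding vs(1) using jblocks_diag_block_mat[OF sq] by blast
  moreover have "int (index_order i) dvd
      charge rep i (sum_list (map jblocks (map (\<lambda>(v, w). v \<boxplus> w) vs)))"
    using vs(2)
  proof (induction vs)
    case (Cons vw vs)
    then show ?case
      using charge_inverse_pair[OF i] by (cases vw) (simp add: charge_add)
  qed (simp add: charge_empty)
  ultimately show ?thesis by simp
qed

text \<open>Reduction modulo 0 is the identity, so one congruence expresses both the parities and
  the integer invariants.\<close>

lemma charge_K1_rel:
  assumes i: "i \<in> jordan_indices" and uv: "(u, v) \<in> K1_rel"
  shows "charge rep i (jblocks u) mod int (index_order i) = charge rep i (jblocks v) mod int (index_order i)"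
proof (rule K1.rel_invariant[OF _ uv])
  fix A B assume "K1_step A B"
  then show "charge rep i (jblocks A) mod int (index_order i) = charge rep i (jblocks B) mod int (index_order i)"
  proof (cases rule: K1_step_cases)
    case 1
    then show ?thesis using jblocks_similar by metis
  next
    case (2 \<xi>)
    then have "\<xi> \<in> GL_mats" using GL_mats_one O_mats_GL by auto
    then obtain n m where nm: "A \<in> carrier_mat n n" "\<xi> \<in> carrier_mat m m"
      using GL_mats_square 2(1) by metis
    have "int (index_order i) dvd charge rep i (jblocks \<xi>)"
      using 2(2) charge_one[OF i] charge_O_mats[OF i] by auto
    then show ?thesis
      unfolding 2(3) jblocks_block_sum[OF nm] charge_add by (auto elim!: dvdE)
  qed
qed

definition K1_charge :: "jordan_index \<Rightarrow> (nat \<Rightarrow> complex mat set) \<Rightarrow> int" where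
  "K1_charge i x = charge rep i (jblocks (SOME u. u \<in> GL_mats \<and> x = K1_class u)) mod int (index_order i)"

lemma K1_charge_class:
  assumes "i \<in> jordan_indices" "u \<in> GL_mats"
  shows "K1_charge i (K1_class u) = charge rep i (jblocks u) mod int (index_order i)"
proof -
  define v where "v = (SOME v. v \<in> GL_mats \<and> K1_class u = K1_class v)"
  have "v \<in> GL_mats \<and> K1_class u = K1_class v"
    unfolding v_def by (rule someI[of _ u]) (simp add: assms)
  then have "(u, v) \<in> K1_rel" unfolding K1_class_eq_iff by simp
  then show ?thesis unfolding K1_charge_def v_def[symmetric] using charge_K1_rel[OF assms(1)] by simp
qed

lemma K1_charge_hom:
  assumes "i \<in> jordan_indices"
  shows "K1_charge i \<in> hom K1_loc (integer_mod_group (index_order i))"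
proof (rule homI)
  fix x assume "x \<in> carrier K1_loc"
  show "K1_charge i x \<in> carrier (integer_mod_group (index_order i))"
    by (auto simp: carrier_integer_mod_group K1_charge_def)
next
  fix x y assume "x \<in> carrier K1_loc" "y \<in> carrier K1_loc"
  then obtain u v where u: "u \<in> GL_mats" "x = K1_class u" and v: "v \<in> GL_mats" "y = K1_class v"
    unfolding carrier_K1_loc by auto
  obtain n m where nm: "u \<in> carrier_mat n n" "v \<in> carrier_mat m m"
    using GL_mats_square u v by metis
  show "K1_charge i (x \<otimes>\<^bsub>K1_loc\<^esub> y) =
      K1_charge i x \<otimes>\<^bsub>integer_mod_group (index_order i)\<^esub> K1_charge i y"
    unfolding u(2) v(2) mult_K1_loc[OF u(1) v(1)] K1_charge_class[OF assms u(1)]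
      K1_charge_class[OF assms v(1)] K1_charge_class[OF assms GL_mats_block_sum[OF u(1) v(1)]]
      jblocks_block_sum[OF nm] charge_add mult_integer_mod_group
    by (simp add: mod_add_eq)
qed

text \<open>Every generator, of whichever kind, is the class of one block on which the charges
  behave like a dual basis. Orders and charges can then be treated without distinguishing the three
  kinds.\<close>

lemma jordan_genE:
  assumes "j \<in> jordan_indices"
  obtains n a where "n \<ge> 1" "a \<noteq> 0" "jordan_gen rep j = K1_class (jordan_block n a)"
    "\<And>i. i \<in> jordan_indices \<Longrightarrow> charge rep i {#(n, a)#} = (if i = j then 1 else 0)"
    "index_order j = 2 \<Longrightarrow> inverse a = a" "index_order j = 0 \<or> index_order j = 2"
proof (cases j)
  case (Minus n)
  show ?thesis
  proof (rule that[of n "-1"])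
    show "charge rep i {#(n, -1)#} = (if i = j then 1 else 0)" if "i \<in> jordan_indices" for i
    proof (cases i)
      case (Hat k c)
      then have "c \<in> C_hat" using that by (auto simp: jordan_indices_def)
      then show ?thesis
        using rep_neq[of c] inverse_rep_neq[of c] unfolding Hat Minus by auto
    qed (auto simp: Minus)
  qed (use assms Minus in \<open>auto simp: jordan_indices_def\<close>)
next
  case (Plus n)
  show ?thesis
  proof (rule that[of n 1])
    show "charge rep i {#(n, 1)#} = (if i = j then 1 else 0)" if "i \<in> jordan_indices" for i
    proof (cases i)
      case (Hat k c)
      then have "c \<in> C_hat" using that by (auto simp: jordan_indices_def)
      then show ?thesis
        using rep_neq[of c] inverse_rep_neq[of c] unfolding Hat Plus by auto
    qed (auto simp: Plus)
  qed (use assms Plus in \<open>auto simp: jordan_indices_def\<close>)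
next
  case (Hat n c)
  then have c: "n \<ge> 1" "c \<in> C_hat" using assms by (auto simp: jordan_indices_def)
  show ?thesis
  proof (rule that[of n "rep c"])
    show "charge rep i {#(n, rep c)#} = (if i = j then 1 else 0)" if i: "i \<in> jordan_indices" for i
    proof (cases i)
      case (Hat n' c')
      then have c': "c' \<in> C_hat" using i by (auto simp: jordan_indices_def)
      show ?thesis
      proof (cases "c = c'")
        case True
        then show ?thesis
          unfolding Hat \<open>j = Hat n c\<close> using rep_neq_inverse[OF c(2)] by simp
      next
        case False
        then have "rep c \<noteq> rep c'" "rep c \<noteq> inverse (rep c')"
          using rep_eq_iff[OF c(2) c'] by blast+
        with False show ?thesis unfolding Hat \<open>j = Hat n c\<close> by simp
      qed
    qed (use rep_neq[OF c(2)] Hat in auto)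
  qed (use c Hat rep_neq[OF c(2)] in auto)
qed

lemma jordan_gen_closed: "j \<in> jordan_indices \<Longrightarrow> jordan_gen rep j \<in> carrier K1_loc"
  by (elim jordan_genE) (auto intro!: K1_class_closed GL_mats_jordan_block simp del: One_nat_def)

lemma K1_charge_gen:
  assumes "i \<in> jordan_indices" "j \<in> jordan_indices"
  shows "K1_charge i (jordan_gen rep j) = (if i = j then 1 mod int (index_order i) else 0)"
  using assms(2)
proof (rule jordan_genE)
  fix n a
  assume *: "n \<ge> 1" "a \<noteq> 0" "jordan_gen rep j = K1_class (jordan_block n a)"
    "\<And>i. i \<in> jordan_indices \<Longrightarrow> charge rep i {#(n, a)#} = (if i = j then 1 else 0)"
  show ?thesis
    using *(4)[OF assms(1)] GL_mats_jordan_block[OF *(1,2)]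
    by (simp add: *(3) K1_charge_class[OF assms(1)] jblocks_jordan_block[OF *(1)])
qed

text \<open>If \<open>a\<close> is its own inverse, the class is its own group inverse; for order 0
  the power is the zeroth one.\<close>

lemma jordan_gen_pow:
  assumes "j \<in> jordan_indices"
  shows "jordan_gen rep j [^]\<^bsub>K1_loc\<^esub> index_order j = \<one>\<^bsub>K1_loc\<^esub>"
  using assms
proof (rule jordan_genE)
  fix n a
  assume *: "n \<ge> 1" "a \<noteq> 0" "jordan_gen rep j = K1_class (jordan_block n a)"
    "index_order j = 2 \<Longrightarrow> inverse a = a" "index_order j = 0 \<or> index_order j = 2"
  interpret comm_group K1_loc by (rule comm_group_K1_loc)
  have c: "jordan_gen rep j \<in> carrier K1_loc" using jordan_gen_closed[OF assms] .
  show ?thesis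
  proof (cases "index_order j = 0")
    case False
    then have 2: "index_order j = 2" using *(5) by simp
    have "inv\<^bsub>K1_loc\<^esub> jordan_gen rep j = jordan_gen rep j"
      using K1_class_jordan_block_inverse[OF *(1,2)] *(4)[OF 2] *(3) by simp
    then have "jordan_gen rep j \<otimes>\<^bsub>K1_loc\<^esub> jordan_gen rep j = \<one>\<^bsub>K1_loc\<^esub>"
      using r_inv[OF c] by simp
    then show ?thesis unfolding 2 numeral_2_eq_2 using c by simp
  qed simp
qed

section \<open>The Jordan classes generate \<open>K1_loc\<close>\<close>

lemma jordan_block_generate:
  assumes "n \<ge> 1" "a \<noteq> 0"
  shows "K1_class (jordan_block n a) \<in> generate K1_loc (jordan_gen rep ` jordan_indices)"
proof -
  interpret comm_group K1_loc by (rule comm_group_K1_loc)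
  have gen: "jordan_gen rep j \<in> generate K1_loc (jordan_gen rep ` jordan_indices)"
    "inv\<^bsub>K1_loc\<^esub> jordan_gen rep j \<in> generate K1_loc (jordan_gen rep ` jordan_indices)"
    if "j \<in> jordan_indices" for j
    using that by (auto intro: generate.incl generate.inv)
  consider "a = -1" | "a = 1" "n \<ge> 2" | "a = 1" "n = 1" | "a \<noteq> 1" "a \<noteq> -1"
    using assms(1) by linarith
  then show ?thesis
  proof cases
    case 1
    then show ?thesis using gen(1)[of "Minus n"] assms by (simp add: jordan_indices_def)
  next
    case 2
    then show ?thesis using gen(1)[of "Plus n"] by (simp add: jordan_indices_def)
  next
    case 3
    \<comment> \<open>The one block with eigenvalue 1 that is not among the generators is an
      identity matrix and represents the unit.\<close>
    have "jordan_block 1 1 = (1\<^sub>m 1 :: complex mat)"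
      by (intro eq_matI) (auto simp: jordan_block_def)
    then show ?thesis unfolding 3 using generate.one[of K1_loc] one_K1_loc by metis
  next
    case 4
    then obtain c where c: "c \<in> C_hat" "rep c = a \<or> rep c = inverse a"
      using C_hat_cases[OF assms(2) _ _ rep] by metis
    have H: "Hat n c \<in> jordan_indices" using c assms by (simp add: jordan_indices_def)
    \<comment> \<open>If the chosen representative is \<open>inverse a\<close>, the class in
      question is the group inverse of the generator.\<close>
    have "inverse a \<noteq> 0" using assms by simp
    with c(2) show ?thesis
      using gen[OF H] K1_class_jordan_block_inverse[OF assms(1), of "inverse a"] by auto
  qed
qed

lemma jordan_matrix_generate:
  "xs \<noteq> [] \<Longrightarrow> 0 \<notin> fst ` set xs \<Longrightarrow> 0 \<notin> snd ` set xs \<Longrightarrow>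
    K1_class (jordan_matrix xs) \<in> generate K1_loc (jordan_gen rep ` jordan_indices)"
proof (induction xs rule: list_nonempty_induct)
  case (single x)
  then show ?case using jordan_block_generate[of "fst x" "snd x"]
    by (cases x) (auto simp: jordan_matrix_singleton Suc_le_eq)
next
  case (cons x xs)
  obtain n a where x: "x = (n, a)" by force
  have na: "n \<ge> 1" "a \<noteq> 0" using cons.prems x by (auto simp: Suc_le_eq)
  have "jordan_matrix (x # xs) = jordan_block n a \<boxplus> jordan_matrix xs"
    using jordan_matrix_append[of "[x]" xs] by (simp add: jordan_matrix_singleton x)
  moreover have "jordan_matrix xs \<in> GL_mats" using cons by (intro GL_mats_jordan_matrix) auto
  ultimately have "K1_class (jordan_matrix (x # xs)) =
      K1_class (jordan_block n a) \<otimes>\<^bsub>K1_loc\<^esub> K1_class (jordan_matrix xs)"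
    using mult_K1_loc GL_mats_jordan_block[OF na] by simp
  moreover have "K1_class (jordan_matrix xs) \<in> generate K1_loc (jordan_gen rep ` jordan_indices)"
    using cons by auto
  ultimately show ?case using generate.eng[OF jordan_block_generate[OF na]] by simp
qed

lemma K1_loc_generate: "carrier K1_loc \<subseteq> generate K1_loc (jordan_gen rep ` jordan_indices)"
proof
  fix x assume "x \<in> carrier K1_loc"
  then obtain u where u: "u \<in> GL_mats" "x = K1_class u" unfolding carrier_K1_loc by auto
  then obtain n where n: "n \<ge> 1" "u \<in> carrier_mat n n" "det u \<noteq> 0" unfolding GL_mats_iff by auto
  obtain xs where xs: "jordan_nf u xs" using jordan_nf_ex[OF n(2)] .
  have 0: "0 \<notin> fst ` set xs" and sim: "similar_mat u (jordan_matrix xs)"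
    using xs by (auto simp: jordan_nf_def)
  have "0 \<notin> snd ` set xs" using det_eq_0_iff_jblocks[OF n(2)] n(3) jblocks_eq[OF xs] by simp
  \<comment> \<open>An empty block list would make \<open>u\<close> a matrix of size 0, which
    \<open>GL_mats\<close> excludes.\<close>
  moreover have "xs \<noteq> []"
  proof
    assume "xs = []"
    then have "jordan_matrix xs \<in> carrier_mat 0 0" using jordan_matrix_carrier[of xs] by simp
    then have "u \<in> carrier_mat 0 0" using similar_mat_square[OF similar_mat_sym[OF sim]] by blast
    then show False using n by auto
  qed
  moreover have "x = K1_class (jordan_matrix xs)"
    unfolding u(2) using u(1) similar_mat_sym[OF sim] by (rule K1_class_similar)
  ultimately show "x \<in> generate K1_loc (jordan_gen rep ` jordan_indices)"
    using jordan_matrix_generate 0 by blast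
qed

lemma internal_direct_sum_K1_loc:
  "internal_direct_sum K1_loc jordan_indices (\<lambda>i. generate K1_loc {jordan_gen rep i})"
  by (rule comm_group.internal_direct_sumI[OF comm_group_K1_loc _ K1_charge_hom K1_charge_gen
        jordan_gen_pow K1_loc_generate]) (use jordan_gen_closed in auto)

lemma card_generate_gen:
  assumes "j \<in> jordan_indices" "index_order j = 2"
  shows "card (generate K1_loc {jordan_gen rep j}) = 2"
proof (rule card_generate_2)
  interpret comm_group K1_loc by (rule comm_group_K1_loc)
  show "group K1_loc" by (rule group_axioms)
  show c: "jordan_gen rep j \<in> carrier K1_loc" using jordan_gen_closed[OF assms(1)] .
  show "jordan_gen rep j \<otimes>\<^bsub>K1_loc\<^esub> jordan_gen rep j = \<one>\<^bsub>K1_loc\<^esub>"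
    using jordan_gen_pow[OF assms(1)] c unfolding assms(2) numeral_2_eq_2 by simp
  \<comment> \<open>The charge of the generator is 1 modulo 2 and separates it from the
    unit.\<close>
  have "K1_charge j \<one>\<^bsub>K1_loc\<^esub> = 0"
    using hom_one[OF K1_charge_hom[OF assms(1)]] by (simp add: group_axioms)
  then show "jordan_gen rep j \<noteq> \<one>\<^bsub>K1_loc\<^esub>"
    using K1_charge_gen[OF assms(1) assms(1)] assms(2) by auto
qed

lemma infinite_generate_gen:
  assumes "j \<in> jordan_indices" "index_order j = 0"
  shows "infinite (generate K1_loc {jordan_gen rep j})"
proof (rule infinite_generate)
  show "group K1_loc" using comm_group_K1_loc by (simp add: comm_group_def)
  show "jordan_gen rep j \<in> carrier K1_loc" using jordan_gen_closed[OF assms(1)] .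
  show "K1_charge j \<in> hom K1_loc integer_group"
    using K1_charge_hom[OF assms(1)] unfolding assms(2) by (simp add: integer_mod_group_def)
  show "K1_charge j (jordan_gen rep j) \<noteq> 0"
    using K1_charge_gen[OF assms(1) assms(1)] assms(2) by simp
qed

end

lemma K0_loc_integers: "comm_group K0_loc" "K0_loc \<cong> integer_group"
proof -
  show "comm_group K0_loc"
    unfolding K0_loc_def by (intro comm_group_projective_limit_const K0_integers)
  have "K0 \<cong> K0_loc"
    unfolding K0_loc_def using projective_limit_const_iso by (rule is_isoI)
  moreover have "group K0" using K0_integers(1) by (simp add: comm_group_def)
  ultimately have "K0_loc \<cong> K0" using group.iso_sym by blast
  then show "K0_loc \<cong> integer_group" using K0_integers(2) by (rule iso_trans)
qed

theorem theorem3: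
  fixes rep :: "complex set \<Rightarrow> complex"
  assumes rep: "\<And>c. c \<in> C_hat \<Longrightarrow> rep c \<in> c"
  shows
    "(comm_group K0_loc \<and> K0_loc \<cong> integer_group) \<and>
     comm_group K1_loc \<and>
     internal_direct_sum K1_loc jordan_indices
       (\<lambda>i. generate K1_loc {jordan_gen rep i}) \<and>
     (\<forall>n \<ge> 1. card (generate K1_loc {K1_class (jordan_block n (-1))}) = 2) \<and>
     (\<forall>n \<ge> 2. card (generate K1_loc {K1_class (jordan_block n 1)}) = 2) \<and>
     (\<forall>n \<ge> 1. \<forall>c \<in> C_hat. infinite (generate K1_loc {K1_class (jordan_block n (rep c))})) \<and>
     (\<forall>n \<ge> 1. \<forall>a :: complex. a \<noteq> 0 \<longrightarrow>
        (\<forall>m\<^sub>1 m\<^sub>2 :: nat.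
           (K1_class (jordan_block n a) [^]\<^bsub>K1_loc\<^esub> m\<^sub>1) \<otimes>\<^bsub>K1_loc\<^esub>
           (K1_class (jordan_block n (inverse a)) [^]\<^bsub>K1_loc\<^esub> m\<^sub>2) =
           K1_class (jordan_block n a) [^]\<^bsub>K1_loc\<^esub> (int m\<^sub>1 - int m\<^sub>2)) \<and>
        (\<forall>m :: int.
           K1_class (jordan_block n a) [^]\<^bsub>K1_loc\<^esub> (- m) =
           K1_class (jordan_block n (inverse a)) [^]\<^bsub>K1_loc\<^esub> m))"
proof -
  interpret jordan_reps rep using rep by unfold_locales
  interpret comm_group K1_loc by (rule comm_group_K1_loc)
  have minus: "card (generate K1_loc {K1_class (jordan_block n (-1))}) = 2" if "n \<ge> 1" for n
    using card_generate_gen[of "Minus n"] that by (simp add: jordan_indices_def)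
  have plus: "card (generate K1_loc {K1_class (jordan_block n 1)}) = 2" if "n \<ge> 2" for n
    using card_generate_gen[of "Plus n"] that by (simp add: jordan_indices_def)
  have hat: "infinite (generate K1_loc {K1_class (jordan_block n (rep c))})"
    if "n \<ge> 1" "c \<in> C_hat" for n c
    using infinite_generate_gen[of "Hat n c"] that by (simp add: jordan_indices_def)
  have rel: "(K1_class (jordan_block n a) [^]\<^bsub>K1_loc\<^esub> m\<^sub>1) \<otimes>\<^bsub>K1_loc\<^esub>
        (K1_class (jordan_block n (inverse a)) [^]\<^bsub>K1_loc\<^esub> m\<^sub>2) =
        K1_class (jordan_block n a) [^]\<^bsub>K1_loc\<^esub> (int m\<^sub>1 - int m\<^sub>2)"
      "K1_class (jordan_block n a) [^]\<^bsub>K1_loc\<^esub> (- m) =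
        K1_class (jordan_block n (inverse a)) [^]\<^bsub>K1_loc\<^esub> m"
    if "n \<ge> 1" "a \<noteq> 0" for n a and m\<^sub>1 m\<^sub>2 :: nat and m :: int
  proof -
    have c: "K1_class (jordan_block n a) \<in> carrier K1_loc"
      using that by (intro K1_class_closed GL_mats_jordan_block)
    show "(K1_class (jordan_block n a) [^]\<^bsub>K1_loc\<^esub> m\<^sub>1) \<otimes>\<^bsub>K1_loc\<^esub>
        (K1_class (jordan_block n (inverse a)) [^]\<^bsub>K1_loc\<^esub> m\<^sub>2) =
        K1_class (jordan_block n a) [^]\<^bsub>K1_loc\<^esub> (int m\<^sub>1 - int m\<^sub>2)"
      \<comment> \<open>Once the class at \<open>inverse a\<close> is written as a group inverse,
        both relations are laws of powers.\<close>
      unfolding K1_class_jordan_block_inverse[OF that]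
      using c by (simp add: int_pow_diff int_pow_int nat_pow_inv)
    show "K1_class (jordan_block n a) [^]\<^bsub>K1_loc\<^esub> (- m) =
        K1_class (jordan_block n (inverse a)) [^]\<^bsub>K1_loc\<^esub> m"
      unfolding K1_class_jordan_block_inverse[OF that]
      using c by (simp add: int_pow_neg int_pow_inv)
  qed
  show ?thesis
    using K0_loc_integers comm_group_K1_loc internal_direct_sum_K1_loc minus plus hat rel by blast
qed

end
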